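(* Let $0\le\alpha\le1$ and $0\le c\le1$. Let $(\widetilde{T}_n,n\ge1)$ be the sequence of trees obtained by growing colour-marked binary trees $(T_n^{\rm col},n\ge1)$ according to the alpha model growth rules (with parameter $\alpha$) together with the colouring rule (with parameter $c$), and then crushing all red edges. Then $(\widetilde{T}_n,n\ge1)$ is a sequence of alpha-gamma trees with parameters $\alpha$ and $\gamma=\alpha(1-c)$ (that is, it has the distribution of the sequence of trees grown by the alpha-gamma growth rules).
   Context: Trees. Let $\mathbb{T}_n$ be the set of combinatorial trees without degree-2 vertices that have one degree-1 vertex called the root and exactly $n$ further degree-1 vertices (leaves) labelled by $\{1,\ldots,n\}$; the other vertices are branch points; edges are directed away from the root. Trees are identified if there is an isomorphism preserving root and leaf labels. Alpha-gamma trees. For $0\le\alpha\le1$, $0\le\gamma\le\alpha$: $T_1,T_2$ are the unique elements of $\mathbb{T}_1,\mathbb{T}_2$. Given $T_n$, $n\ge 2$: assign weight $1-\alpha$ to each of the $n$ edges adjacent to a leaf, weight $\gamma$ to each other edge (including the edge adjacent to the root), and weight $(k-1)\alpha-\gamma$ to each vertex of degree $k+1\ge 3$; select an edge $a\to c$ or a branch point $v$ at random with probability proportional to weight; if an edge $a\to c$ was selected, replace it by three edges $a\to b$, $b\to c$, $b\to n+1$, where $b$ is a new branch point and $n+1$ a new leaf; if a vertex $v$ was selected, add an edge $v\to n+1$ to a new leaf $n+1$. The result is $T_{n+1}$. Alpha model growth rules. Start from the unique elements of $\mathbb{T}_1$ and $\mathbb{T}_2$. Given the binary tree with $n\ge2$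 leaves, assign weight $1-\alpha$ to each of the $n$ edges adjacent to a leaf and weight $\alpha$ to each of the $n-1$ other edges; select an edge $a_n\to c_n$ with probability proportional to weight; replace it by three edges $a_n\to b_n$, $b_n\to c_n$, $b_n\to n+1$, with $b_n$ a new branch point and $n+1$ a new leaf. Colouring rule. In $T_n^{\rm col}$ each edge not adjacent to a leaf carries a colour, blue or red. In $T_2^{\rm col}$ the edge adjacent to the root is blue. When passing from $T_n^{\rm col}$ to $T_{n+1}^{\rm col}$, keep existing colours and: if the selected edge $a_n\to c_n$ is adjacent to a leaf, mark $a_n\to b_n$ blue; if $a_n\to c_n$ is red, mark both $a_n\to b_n$ and $b_n\to c_n$ red; if $a_n\to c_n$ is blue, mark $a_n\to b_n$ blue, and mark $b_n\to c_n$ red with probability $c$ and blue with probability $1-c$ (independently of everything else). Crushing. For each $n$, $\widetilde{T}_n$ is obtained from $T_n^{\rm col}$ by identifying all vertices connected via red edges, removing all red edges, and removing the remaining colour marks. *)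

theory Defs
  imports "HOL-Probability.Probability"
begin

subsection \<open>Rooted trees with labelled leaves\<close>

text \<open>
  Edges are directed away from the root.  The root and the leaves are part of the structure, so
  that isomorphisms have to preserve the root and the leaf labels.
\<close>

record 'v ltree =
  root_of :: 'v
  leaf_at :: "nat \<rightharpoonup> 'v"
  edges :: "('v \<times> 'v) set"

definition verts :: "'v ltree \<Rightarrow> 'v set" where
  "verts t = insert (root_of t) (ran (leaf_at t) \<union> Field (edges t))"

definition leaves :: "'v ltree \<Rightarrow> 'v set" where
  "leaves t = ran (leaf_at t)"

definition deg :: "'v ltree \<Rightarrow> 'v \<Rightarrow> nat" where
  "deg t v = card {e \<in> edges t. fst e = v \<or> snd e = v}"

definition labelled_tree :: "nat \<Rightarrow> 'v ltree \<Rightarrow> bool" where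
  "labelled_tree n t \<longleftrightarrow>
     finite (edges t) \<and>
     (\<forall>v\<in>verts t. (root_of t, v) \<in> (edges t)\<^sup>*) \<and>
     (\<forall>u. (u, root_of t) \<notin> edges t) \<and>
     (\<forall>u v w. (u, w) \<in> edges t \<longrightarrow> (v, w) \<in> edges t \<longrightarrow> u = v) \<and>
     dom (leaf_at t) = {1..n} \<and> inj_on (leaf_at t) {1..n} \<and> root_of t \<notin> leaves t \<and>
     {v \<in> verts t. deg t v = 1} = insert (root_of t) (leaves t) \<and>
     (\<forall>v\<in>verts t. deg t v \<noteq> 2)"

definition iso :: "'v ltree \<Rightarrow> 'w ltree \<Rightarrow> bool" where
  "iso t t' \<longleftrightarrow>
     (\<exists>f. bij_betw f (verts t) (verts t') \<and> f (root_of t) = root_of t' \<and>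
          (\<forall>i. map_option f (leaf_at t i) = leaf_at t' i) \<and>
          map_prod f f ` edges t = edges t')"

text \<open>
  The isomorphism class of a finite tree.  Taking representatives with vertices in \<^typ>\<open>nat\<close> makes
  classes of trees with different vertex types comparable.
\<close>

definition iso_class :: "'v ltree \<Rightarrow> nat ltree set" where
  "iso_class t = {t'. iso t t'}"

subsection \<open>Growth\<close>

text \<open>
  During growth, \<open>Leaf i\<close> is the leaf with label \<open>i\<close>, and \<open>Branch i\<close> names the branch
  point that is created (if any) together with it.
\<close>

datatype vertex = Root | Leaf nat | Branch nat

definition tree1 :: "vertex ltree" where
  "tree1 = \<lparr>root_of = Root, leaf_at = [1 \<mapsto> Leaf 1], edges = {(Root, Leaf 1)}\<rparr>"

definition tree2 :: "vertex ltree" where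
  "tree2 = \<lparr>root_of = Root, leaf_at = [1 \<mapsto> Leaf 1, 2 \<mapsto> Leaf 2],
            edges = {(Root, Branch 2), (Branch 2, Leaf 1), (Branch 2, Leaf 2)}\<rparr>"

definition grow_edge :: "nat \<Rightarrow> vertex \<times> vertex \<Rightarrow> vertex ltree \<Rightarrow> vertex ltree" where
  "grow_edge n = (\<lambda>(a, x) t. t\<lparr>
     leaf_at := (leaf_at t)(Suc n \<mapsto> Leaf (Suc n)),
     edges := (edges t - {(a, x)}) \<union>
              {(a, Branch (Suc n)), (Branch (Suc n), x), (Branch (Suc n), Leaf (Suc n))}\<rparr>)"

definition grow_vertex :: "nat \<Rightarrow> vertex \<Rightarrow> vertex ltree \<Rightarrow> vertex ltree" where
  "grow_vertex n v t = t\<lparr>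
     leaf_at := (leaf_at t)(Suc n \<mapsto> Leaf (Suc n)),
     edges := insert (v, Leaf (Suc n)) (edges t)\<rparr>"

definition fresh :: "nat \<Rightarrow> vertex ltree \<Rightarrow> bool" where
  "fresh n t \<longleftrightarrow> Leaf n \<notin> verts t \<and> Branch n \<notin> verts t"

lemma edge_verts: "(u, v) \<in> edges t \<Longrightarrow> u \<in> verts t \<and> v \<in> verts t"
  by (auto simp: verts_def Field_def)

lemma labelled_tree_tree1: "labelled_tree 1 tree1"
proof -
  have v: "verts tree1 = {Root, Leaf 1}"
    by (auto simp: verts_def tree1_def Field_def)
  have d: "deg tree1 v = (if v = Root \<or> v = Leaf 1 then 1 else 0)" for v
  proof -
    have "{e \<in> edges tree1. fst e = v \<or> snd e = v} = (if v = Root \<or> v = Leaf 1 then {(Root, Leaf 1)} else {})"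
      by (auto simp: tree1_def)
    then show ?thesis by (simp add: deg_def)
  qed
  show ?thesis
    unfolding labelled_tree_def v d leaves_def
    by (auto simp: tree1_def)
qed

lemma labelled_tree_tree2: "labelled_tree 2 tree2"
proof -
  have v: "verts tree2 = {Root, Branch 2, Leaf 1, Leaf 2}"
    by (auto simp: verts_def tree2_def Field_def)
  have "{e \<in> edges tree2. fst e = v \<or> snd e = v} = (case v of Root \<Rightarrow> {(Root, Branch 2)}
      | Branch i \<Rightarrow> (if i = 2 then {(Root, Branch 2), (Branch 2, Leaf 1), (Branch 2, Leaf 2)} else {})
      | Leaf i \<Rightarrow> (if i = 1 \<or> i = 2 then {(Branch 2, v)} else {}))" for v
    by (auto simp: tree2_def split: vertex.splits)
  then have d: "deg tree2 v = (case v of Root \<Rightarrow> 1 | Branch i \<Rightarrow> (if i = 2 then 3 else 0)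
      | Leaf i \<Rightarrow> (if i = 1 \<or> i = 2 then 1 else 0))" for v
    unfolding deg_def by (simp split: vertex.splits)
  have "(Root, Leaf i) \<in> (edges tree2)\<^sup>*" if "i = 1 \<or> i = 2" for i
  proof (rule rtrancl_trans[OF r_into_rtrancl r_into_rtrancl])
    show "(Root, Branch 2) \<in> edges tree2" by (simp add: tree2_def)
    show "(Branch 2, Leaf i) \<in> edges tree2" using that by (auto simp: tree2_def)
  qed
  moreover have "(Root, Branch 2) \<in> (edges tree2)\<^sup>*"
    by (rule r_into_rtrancl) (simp add: tree2_def)
  moreover have "root_of tree2 = Root" by (simp add: tree2_def)
  moreover have "leaf_at tree2 = [1 \<mapsto> Leaf 1, 2 \<mapsto> Leaf 2]" by (simp add: tree2_def)
  moreover have "{1..2} = {1, 2::nat}" by auto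
  moreover have "finite (edges tree2)" by (simp add: tree2_def)
  moreover have "(u, Root) \<notin> edges tree2" for u by (simp add: tree2_def)
  moreover have "(u, w) \<in> edges tree2 \<Longrightarrow> (v, w) \<in> edges tree2 \<Longrightarrow> u = v" for u v w
    by (auto simp: tree2_def)
  ultimately show ?thesis
    unfolding labelled_tree_def v d leaves_def
    by (auto simp: inj_on_def ran_map_upd split: if_splits)
qed

lemma labelled_tree_grow_edge:
  assumes t: "labelled_tree n t" and e: "(a, x) \<in> edges t" and fr: "fresh (Suc n) t"
  shows "labelled_tree (Suc n) (grow_edge n (a, x) t)"
proof -
  let ?t = "grow_edge n (a, x) t" and ?b = "Branch (Suc n)" and ?l = "Leaf (Suc n)"
  have f: "?b \<notin> verts t" "?l \<notin> verts t" using fr by (auto simp: fresh_def)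
  have fe: "(u, ?b) \<notin> edges t" "(u, ?l) \<notin> edges t" "(?b, u) \<notin> edges t" "(?l, u) \<notin> edges t" for u
    using f edge_verts[of _ _ t] by auto
  have root: "root_of ?t = root_of t" by (simp add: grow_edge_def)
  have edges: "edges ?t = edges t - {(a, x)} \<union> {(a, ?b), (?b, x), (?b, ?l)}"
    by (simp add: grow_edge_def)
  have leaf: "leaf_at ?t = (leaf_at t)(Suc n \<mapsto> ?l)" by (simp add: grow_edge_def)
  have dom: "dom (leaf_at t) = {1..n}" and inj: "inj_on (leaf_at t) {1..n}" and fin: "finite (edges t)"
    using t by (auto simp: labelled_tree_def)
  have sn: "leaf_at t (Suc n) = None" using dom by (metis atLeastAtMost_iff domIff not_less_eq_eq order_refl)
  have leaves: "leaves ?t = insert ?l (leaves t)"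
    unfolding leaves_def leaf using sn by (simp add: ran_map_upd)
  have ax: "a \<in> verts t" "x \<in> verts t" using edge_verts[OF e] by auto
  have verts: "verts ?t = verts t \<union> {?b, ?l}"
  proof -
    have "Field (edges ?t) = Field (edges t) \<union> {?b, ?l}"
      using e by (auto simp: edges Field_def)
    then show ?thesis
      using leaves by (auto simp: verts_def root leaves_def)
  qed
  have neq: "?b \<noteq> a" "?b \<noteq> x" "?l \<noteq> a" "?l \<noteq> x" "?b \<noteq> ?l" using f ax by auto
  have reach: "(root_of t, v) \<in> (edges ?t)\<^sup>*" if "v \<in> verts ?t" for v
  proof -
    have "edges t \<subseteq> (edges ?t)\<^sup>*"
    proof
      fix p assume p: "p \<in> edges t"
      have "(a, ?b) \<in> edges ?t" "(?b, x) \<in> edges ?t" by (auto simp: edges)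
      then have "(a, x) \<in> (edges ?t)\<^sup>*" by (meson converse_rtrancl_into_rtrancl rtrancl.rtrancl_refl)
      then show "p \<in> (edges ?t)\<^sup>*" using p by (cases "p = (a, x)") (auto simp: edges)
    qed
    then have sub: "(edges t)\<^sup>* \<subseteq> (edges ?t)\<^sup>*" by (metis rtrancl_mono rtrancl_idemp)
    have old: "(root_of t, v) \<in> (edges ?t)\<^sup>*" if "v \<in> verts t" for v
      using t that sub by (auto simp: labelled_tree_def)
    have b: "(root_of t, ?b) \<in> (edges ?t)\<^sup>*"
      by (rule rtrancl_into_rtrancl[OF old[OF ax(1)]]) (simp add: edges)
    have "(root_of t, ?l) \<in> (edges ?t)\<^sup>*"
      by (rule rtrancl_into_rtrancl[OF b]) (simp add: edges)
    with b old that verts show ?thesis by auto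
  qed
  have dg: "deg ?t v = deg t v" if "v \<in> verts t" for v
  proof -
    have v: "v \<noteq> ?b" "v \<noteq> ?l" using f that by auto
    have loop: "a \<noteq> x"
    proof
      assume "a = x"
      have no: "(root_of t, u) \<in> (edges t)\<^sup>* \<Longrightarrow> u \<noteq> x" for u
      proof (induction rule: rtrancl_induct)
        case base
        then show ?case using e t by (auto simp: labelled_tree_def)
      next
        case (step y z)
        then show ?case using e t \<open>a = x\<close> unfolding labelled_tree_def by blast
      qed
      then show False using t ax by (auto simp: labelled_tree_def)
    qed
    define g where "g p = (if p = (a, x) then (if v = a then (a, ?b) else (?b, x)) else p)" for p
    have "{p \<in> edges ?t. fst p = v \<or> snd p = v} = g ` {p \<in> edges t. fst p = v \<or> snd p = v}"
      using v e neq loop unfolding g_def edges by (auto simp: image_iff)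
    moreover have "inj_on g {p \<in> edges t. fst p = v \<or> snd p = v}"
      using fe by (auto simp: inj_on_def g_def split: if_splits)
    ultimately show ?thesis by (simp add: deg_def card_image)
  qed
  have "{p \<in> edges ?t. fst p = ?b \<or> snd p = ?b} = {(a, ?b), (?b, x), (?b, ?l)}"
    using fe by (auto simp: edges)
  then have degb: "deg ?t ?b = 3" using neq by (simp add: deg_def)
  have "{p \<in> edges ?t. fst p = ?l \<or> snd p = ?l} = {(?b, ?l)}"
    using fe neq by (auto simp: edges)
  then have degl: "deg ?t ?l = 1" by (simp add: deg_def)
  have lv: "leaves t \<subseteq> verts t" by (auto simp: leaves_def verts_def)
  have rv: "root_of t \<in> verts t" by (auto simp: verts_def)
  have "inj_on (leaf_at ?t) {1..Suc n}"
  proof -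
    have "leaf_at t i \<noteq> Some ?l" for i using f lv by (auto simp: leaves_def ran_def)
    then have "Some ?l \<notin> leaf_at t ` {1..n}" by (metis imageE)
    moreover have "{1..Suc n} = insert (Suc n) {1..n}" by auto
    ultimately show ?thesis using inj unfolding leaf
      by (auto intro: inj_on_fun_updI)
  qed
  moreover have "dom (leaf_at ?t) = {1..Suc n}" using dom by (auto simp: leaf)
  moreover have "{v \<in> verts ?t. deg ?t v = 1} = insert (root_of t) (leaves ?t)"
  proof -
    have "{v \<in> verts ?t. deg ?t v = 1} = insert ?l {v \<in> verts t. deg t v = 1}"
      using dg degb degl f unfolding verts by auto
    then show ?thesis using t leaves by (auto simp: labelled_tree_def)
  qed
  moreover have "\<forall>v\<in>verts ?t. deg ?t v \<noteq> 2"
    using dg degb degl t unfolding verts by (auto simp: labelled_tree_def)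
  moreover have "\<forall>u. (u, root_of t) \<notin> edges ?t"
    using t e f rv unfolding edges by (auto simp: labelled_tree_def)
  moreover have "\<forall>u v w. (u, w) \<in> edges ?t \<longrightarrow> (v, w) \<in> edges ?t \<longrightarrow> u = v"
  proof -
    have un: "\<And>u v w. (u, w) \<in> edges t \<Longrightarrow> (v, w) \<in> edges t \<Longrightarrow> u = v"
      using t by (auto simp: labelled_tree_def)
    show ?thesis
      using fe e neq unfolding edges by (auto dest: un)
  qed
  moreover have "root_of t \<notin> leaves ?t" using t leaves f rv by (auto simp: labelled_tree_def)
  moreover have "finite (edges ?t)" using fin by (simp add: edges)
  ultimately show ?thesis
    unfolding labelled_tree_def root using reach by blast
qed

lemma labelled_tree_grow_vertex:
  assumes t: "labelled_tree n t" and vt: "v \<in> verts t" "deg t v \<ge> 3" and fr: "fresh (Suc n) t"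
  shows "labelled_tree (Suc n) (grow_vertex n v t)"
proof -
  let ?t = "grow_vertex n v t" and ?l = "Leaf (Suc n)"
  have f: "?l \<notin> verts t" using fr by (auto simp: fresh_def)
  have fe: "(u, ?l) \<notin> edges t" "(?l, u) \<notin> edges t" for u
    using f edge_verts[of _ _ t] by auto
  have root: "root_of ?t = root_of t" by (simp add: grow_vertex_def)
  have edges: "edges ?t = insert (v, ?l) (edges t)" by (simp add: grow_vertex_def)
  have leaf: "leaf_at ?t = (leaf_at t)(Suc n \<mapsto> ?l)" by (simp add: grow_vertex_def)
  have dom: "dom (leaf_at t) = {1..n}" and inj: "inj_on (leaf_at t) {1..n}" and fin: "finite (edges t)"
    using t by (auto simp: labelled_tree_def)
  have sn: "leaf_at t (Suc n) = None" using dom by (metis atLeastAtMost_iff domIff not_less_eq_eq order_refl)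
  have leaves: "leaves ?t = insert ?l (leaves t)"
    unfolding leaves_def leaf using sn by (simp add: ran_map_upd)
  have verts: "verts ?t = insert ?l (verts t)"
  proof -
    have "Field (edges ?t) = insert v (insert ?l (Field (edges t)))"
      by (auto simp: edges Field_def)
    then show ?thesis
      using leaves vt by (auto simp: verts_def root leaves_def)
  qed
  have neq: "?l \<noteq> v" using f vt by auto
  have reach: "(root_of t, u) \<in> (edges ?t)\<^sup>*" if "u \<in> verts ?t" for u
  proof -
    have sub: "(edges t)\<^sup>* \<subseteq> (edges ?t)\<^sup>*" by (rule rtrancl_mono) (auto simp: edges)
    have old: "(root_of t, u) \<in> (edges ?t)\<^sup>*" if "u \<in> verts t" for u
      using t that sub by (auto simp: labelled_tree_def)
    have "(root_of t, ?l) \<in> (edges ?t)\<^sup>*"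
      by (rule rtrancl_into_rtrancl[OF old[OF vt(1)]]) (simp add: edges)
    with old that verts show ?thesis by auto
  qed
  have dg: "deg ?t u = (if u = v then Suc (deg t u) else deg t u)" if "u \<in> verts t" for u
  proof -
    have u: "u \<noteq> ?l" using f that by auto
    have "{p \<in> edges ?t. fst p = u \<or> snd p = u} =
      (if u = v then insert (v, ?l) {p \<in> edges t. fst p = u \<or> snd p = u} else {p \<in> edges t. fst p = u \<or> snd p = u})"
      using u by (auto simp: edges)
    then show ?thesis using fe fin by (simp add: deg_def)
  qed
  have "{p \<in> edges ?t. fst p = ?l \<or> snd p = ?l} = {(v, ?l)}"
    using fe neq by (auto simp: edges)
  then have degl: "deg ?t ?l = 1" by (simp add: deg_def)
  have lv: "leaves t \<subseteq> verts t" by (auto simp: leaves_def verts_def)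
  have rv: "root_of t \<in> verts t" by (auto simp: verts_def)
  have "inj_on (leaf_at ?t) {1..Suc n}"
  proof -
    have "leaf_at t i \<noteq> Some ?l" for i using f lv by (auto simp: leaves_def ran_def)
    then have "Some ?l \<notin> leaf_at t ` {1..n}" by (metis imageE)
    moreover have "{1..Suc n} = insert (Suc n) {1..n}" by auto
    ultimately show ?thesis using inj unfolding leaf
      by (auto intro: inj_on_fun_updI)
  qed
  moreover have "dom (leaf_at ?t) = {1..Suc n}" using dom by (auto simp: leaf)
  moreover have "{u \<in> verts ?t. deg ?t u = 1} = insert (root_of t) (leaves ?t)"
  proof -
    have "{u \<in> verts ?t. deg ?t u = 1} = insert ?l {u \<in> verts t. deg t u = 1}"
      using dg degl f vt unfolding verts by (auto split: if_splits)
    then show ?thesis using t leaves by (auto simp: labelled_tree_def)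
  qed
  moreover have "\<forall>u\<in>verts ?t. deg ?t u \<noteq> 2"
    using dg degl t vt unfolding verts by (auto simp: labelled_tree_def)
  moreover have "\<forall>u. (u, root_of t) \<notin> edges ?t"
    using t f rv unfolding edges by (auto simp: labelled_tree_def)
  moreover have "\<forall>u v w. (u, w) \<in> edges ?t \<longrightarrow> (v, w) \<in> edges ?t \<longrightarrow> u = v"
  proof -
    have un: "\<And>u v w. (u, w) \<in> edges t \<Longrightarrow> (v, w) \<in> edges t \<Longrightarrow> u = v"
      using t by (auto simp: labelled_tree_def)
    show ?thesis
      using fe neq unfolding edges by (auto dest: un)
  qed
  moreover have "root_of t \<notin> leaves ?t" using t leaves f rv by (auto simp: labelled_tree_def)
  moreover have "finite (edges ?t)" using fin by (simp add: edges)
  ultimately show ?thesis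
    unfolding labelled_tree_def root using reach by blast
qed

text \<open>
  Selection with probability proportional to the weight.  In all uses below the weights are
  non-negative and, on a tree with \<open>n\<close> leaves, sum up to \<open>n - \<alpha>\<close>.
\<close>

definition select :: "'s set \<Rightarrow> ('s \<Rightarrow> real) \<Rightarrow> 's pmf" where
  "select S w = embed_pmf (\<lambda>s. if s \<in> S then w s / sum w S else 0)"

text \<open>
  A sequence that starts with \<open>s1\<close>, \<open>s2\<close> and is such that, for \<open>n \<ge> 2\<close>, the conditional
  distribution of \<open>X (n + 1)\<close> given \<open>X 1, \<dots>, X n\<close> is \<open>step n (X n)\<close>.
\<close>

definition grown :: "'w measure \<Rightarrow> 's \<Rightarrow> 's \<Rightarrow> (nat \<Rightarrow> 's \<Rightarrow> 's pmf) \<Rightarrow> (nat \<Rightarrow> 'w \<Rightarrow> 's) \<Rightarrow> bool" where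
  "grown M s1 s2 step X \<longleftrightarrow>
     prob_space M \<and>
     (\<forall>n\<ge>1. X n \<in> M \<rightarrow>\<^sub>M count_space UNIV) \<and>
     (AE \<omega> in M. X 1 \<omega> = s1) \<and> (AE \<omega> in M. X 2 \<omega> = s2) \<and>
     (\<forall>n\<ge>2. \<forall>h s.
        measure M {\<omega> \<in> space M. (\<forall>k\<in>{1..n}. X k \<omega> = h k) \<and> X (Suc n) \<omega> = s} =
        measure M {\<omega> \<in> space M. \<forall>k\<in>{1..n}. X k \<omega> = h k} * pmf (step n (h n)) s)"

lemma grown_exists:
  fixes s1 s2 :: 's and step :: "nat \<Rightarrow> 's \<Rightarrow> 's pmf"
  shows "\<exists>(M :: (nat \<Rightarrow> 's) measure) X. grown M s1 s2 step X"
proof -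
  define K where "K i \<omega> = (if i \<le> 1 then return_pmf s1 else if i = 2 then return_pmf s2
    else step (i - 1) (\<omega> (i - 1)))" for i and \<omega> :: "nat \<Rightarrow> 's"
  let ?N = "\<lambda>_::nat. count_space (UNIV :: 's set)"
  have K_meas: "(\<lambda>\<omega>. measure_pmf (K i \<omega>)) \<in> PiM {0..<i} ?N \<rightarrow>\<^sub>M subprob_algebra (count_space UNIV)" for i
  proof -
    have 1: "(\<lambda>\<omega>. measure_pmf (step (i - 1) (\<omega> (i - 1))))
        \<in> PiM {0..<i} ?N \<rightarrow>\<^sub>M subprob_algebra (count_space UNIV)" if "i > 2"
      using that
      by (intro measurable_compose[OF measurable_component_singleton, where g="\<lambda>s. measure_pmf (step (i-1) s)"])
         (auto simp: space_subprob_algebra prob_space_imp_subprob_space measure_pmf.prob_space_axioms)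
    have 2: "(\<lambda>\<omega>. measure_pmf q) \<in> PiM {0..<i} ?N \<rightarrow>\<^sub>M subprob_algebra (count_space UNIV)" for q :: "'s pmf"
      by (simp add: space_subprob_algebra prob_space_imp_subprob_space measure_pmf.prob_space_axioms)
    consider "i \<le> 1" | "i = 2" | "i > 2" by linarith
    then show ?thesis
      using 1 2 by cases (simp_all add: K_def)
  qed
  interpret IT: Ionescu_Tulcea "\<lambda>i \<omega>. measure_pmf (K i \<omega>)" ?N
    by standard (auto intro: K_meas measure_pmf.prob_space_axioms)
  define L where "L = IT.PF.lim"
  have setsL: "sets L = sets (PiM UNIV ?N)" by (simp add: L_def)
  have spL: "space L = UNIV" using sets_eq_imp_space_eq[OF setsL] by (simp add: space_PiM)
  have comp: "(\<lambda>\<omega>. \<omega> n) \<in> L \<rightarrow>\<^sub>M count_space UNIV" for n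
    unfolding measurable_cong_sets[OF setsL refl] by (rule measurable_component_singleton) auto
  have undef: "(\<lambda>_. undefined) \<in> space (PiM {0..<0} ?N)" by (simp add: space_PiM)
  have emL: "emeasure L {\<omega>. restrict \<omega> {0..<m} \<in> A} = emeasure (IT.C 0 m (\<lambda>_. undefined)) A"
    if A: "A \<in> sets (PiM {0..<m} ?N)" for m A
  proof -
    have "emeasure L (IT.PF.emb UNIV {0..<m} A) = emeasure (IT.C 0 m (\<lambda>_. undefined)) A"
      unfolding L_def using A IT.lim[of "{0..<m}" A] IT.emeasure_CI[of "{0..<m}" m A]
         sets.sets_into_space[OF A]
      by (simp add: prod_emb_id space_PiM)
    moreover have "IT.PF.emb UNIV {0..<m} A = {\<omega>. restrict \<omega> {0..<m} \<in> A}"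
      by (auto simp: prod_emb_def space_PiM)
    ultimately show ?thesis by simp
  qed
  have prob: "prob_space L"
  proof (rule prob_spaceI)
    have "emeasure L {\<omega>. restrict \<omega> {0..<0} \<in> space (PiM {0..<0} ?N)} =
        emeasure (IT.C 0 0 (\<lambda>_. undefined)) (space (PiM {0..<0} ?N))"
      by (rule emL) auto
    moreover have "{\<omega>. restrict \<omega> {0..<0} \<in> space (PiM {0..<0} ?N)} = UNIV"
      by (auto simp: space_PiM)
    moreover have "emeasure (IT.C 0 0 (\<lambda>_. undefined)) (space (PiM {0..<0} ?N)) = 1"
      using prob_space.emeasure_space_1[OF IT.prob_space_C[OF undef, of 0]] IT.space_C[OF undef, of 0]
      by (simp del: IT.C.simps)
    ultimately show "emeasure L (space L) = 1"
      using spL by metis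
  qed
  interpret L: prob_space L by (rule prob)
  have key: "measure L {\<omega>. restrict \<omega> {0..<m} \<in> A \<and> \<omega> m = s} = measure L {\<omega>. restrict \<omega> {0..<m} \<in> A} * p"
    if A: "A \<in> sets (PiM {0..<m} ?N)" and p: "\<And>f. f \<in> A \<Longrightarrow> pmf (K m f) s = p" and p0: "p \<ge> 0" for m A s p
  proof -
    define B where "B = {f \<in> space (PiM {0..<Suc m} ?N). restrict f {0..<m} \<in> A \<and> f m = s}"
    have B: "B \<in> sets (PiM {0..<Suc m} ?N)"
    proof -
      have "(\<lambda>f. restrict f {0..<m}) \<in> PiM {0..<Suc m} ?N \<rightarrow>\<^sub>M PiM {0..<m} ?N"
        by (rule measurable_restrict_subset) simp
      note 1 = measurable_sets[OF this A]
      have "(\<lambda>f. f m) \<in> PiM {0..<Suc m} ?N \<rightarrow>\<^sub>M count_space UNIV"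
        by (rule measurable_component_singleton) auto
      note 2 = measurable_sets[OF this, of "{s}"]
      have "((\<lambda>f. restrict f {0..<m}) -` A \<inter> space (PiM {0..<Suc m} ?N)) \<inter>
          ((\<lambda>f. f m) -` {s} \<inter> space (PiM {0..<Suc m} ?N)) \<in> sets (PiM {0..<Suc m} ?N)"
        by (rule sets.Int[OF 1 2]) simp
      also have "((\<lambda>f. restrict f {0..<m}) -` A \<inter> space (PiM {0..<Suc m} ?N)) \<inter>
          ((\<lambda>f. f m) -` {s} \<inter> space (PiM {0..<Suc m} ?N)) = B" by (auto simp: B_def)
      finally show ?thesis .
    qed
    have "emeasure L {\<omega>. restrict \<omega> {0..<m} \<in> A \<and> \<omega> m = s} = emeasure L {\<omega>. restrict \<omega> {0..<Suc m} \<in> B}"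
      by (rule arg_cong[where f="emeasure L"])
         (auto simp: B_def space_PiM restrict_restrict min_def inf.absorb2 Int_absorb1)
    also have "\<dots> = emeasure (IT.C 0 (Suc m) (\<lambda>_. undefined)) B" by (rule emL[OF B])
    also have "\<dots> = (\<integral>\<^sup>+f. emeasure (IT.eP m f) B \<partial>IT.C 0 m (\<lambda>_. undefined))"
      unfolding IT.C.simps add_0
      using undef B
      by (intro emeasure_bind[where N="PiM {0..<Suc m} ?N"])
         (auto simp: IT.space_C measurable_cong_sets[OF IT.sets_C refl] space_PiM)
    also have "\<dots> = (\<integral>\<^sup>+f. ennreal p * indicator A f \<partial>IT.C 0 m (\<lambda>_. undefined))"
    proof (rule nn_integral_cong)
      fix f assume "f \<in> space (IT.C 0 m (\<lambda>_. undefined))"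
      then have f: "f \<in> space (PiM {0..<m} ?N)" using IT.space_C[OF undef] by simp
      have r: "restrict (f(m := x)) {0..<m} = f" for x
        using f by (auto simp: space_PiM PiE_def extensional_def fun_eq_iff)
      have "f(m := x) \<in> space (PiM {0..<Suc m} ?N)" for x
        using f by (auto simp: space_PiM PiE_def extensional_def)
      then have "(\<lambda>x. f(m := x)) -` B = (if f \<in> A then {s} else {})"
        by (auto simp: B_def r)
      then show "emeasure (IT.eP m f) B = ennreal p * indicator A f"
        using IT.emeasure_eP[OF f B] p by (simp add: emeasure_pmf_single)
    qed
    also have "\<dots> = ennreal p * emeasure (IT.C 0 m (\<lambda>_. undefined)) A"
      using A IT.sets_C[OF undef] by (intro nn_integral_cmult_indicator) auto
    also have "\<dots> = ennreal p * emeasure L {\<omega>. restrict \<omega> {0..<m} \<in> A}" using emL[OF A] by simp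
    finally show ?thesis
      using p0 by (simp add: measure_def enn2real_mult mult.commute)
  qed
  have one: "AE \<omega> in L. \<omega> m = s" if "K m = (\<lambda>_. return_pmf s)" for m s
  proof -
    have S: "{f::nat \<Rightarrow> 's. f m = s} \<in> sets L"
      using measurable_sets[OF comp[of m], of "{s}"] by (simp add: vimage_def spL)
    have "measure L {\<omega>. restrict \<omega> {0..<m} \<in> space (PiM {0..<m} ?N) \<and> \<omega> m = s} = 
       measure L {\<omega>. restrict \<omega> {0..<m} \<in> space (PiM {0..<m} ?N)} * 1"
      by (rule key) (auto simp: that)
    then have "measure L {\<omega>. \<omega> m = s} = 1"
      using L.prob_space by (simp add: space_PiM spL)
    then show ?thesis using L.prob_Collect_eq_1[of "\<lambda>\<omega>. \<omega> m = s"] S by (simp add: spL)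
  qed
  have "grown L s1 s2 step (\<lambda>n \<omega>. \<omega> n)"
    unfolding grown_def
  proof (intro conjI allI impI)
    fix n :: nat and h s assume n: "2 \<le> n"
    define A where "A = {f \<in> space (PiM {0..<Suc n} ?N). \<forall>k\<in>{1..n}. f k = h k}"
    have A: "A \<in> sets (PiM {0..<Suc n} ?N)"
      unfolding A_def
    proof (rule sets.sets_Collect_finite_All)
      fix k assume "k \<in> {1..n}"
      then have "(\<lambda>f. f k) \<in> PiM {0..<Suc n} ?N \<rightarrow>\<^sub>M count_space UNIV"
        by (intro measurable_component_singleton) auto
      from measurable_sets[OF this, of "{h k}"]
      show "{f \<in> space (PiM {0..<Suc n} ?N). f k = h k} \<in> sets (PiM {0..<Suc n} ?N)"
        by (simp add: vimage_def Collect_conj_eq Int_commute)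
    qed auto
    have eq: "{\<omega>. restrict \<omega> {0..<Suc n} \<in> A} = {\<omega>. \<forall>k\<in>{1..n}. \<omega> k = h k}"
      by (auto simp: A_def space_PiM)
    have "measure L {\<omega>. restrict \<omega> {0..<Suc n} \<in> A \<and> \<omega> (Suc n) = s} =
        measure L {\<omega>. restrict \<omega> {0..<Suc n} \<in> A} * pmf (step n (h n)) s"
      using n by (intro key A) (auto simp: K_def A_def)
    moreover have "{\<omega>. restrict \<omega> {0..<Suc n} \<in> A \<and> \<omega> (Suc n) = s} = {\<omega>. (\<forall>k\<in>{1..n}. \<omega> k = h k) \<and> \<omega> (Suc n) = s}"
      using eq by blast
    ultimately show "measure L {\<omega> \<in> space L. (\<forall>k\<in>{1..n}. \<omega> k = h k) \<and> \<omega> (Suc n) = s} =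
        measure L {\<omega> \<in> space L. \<forall>k\<in>{1..n}. \<omega> k = h k} * pmf (step n (h n)) s"
      using eq by (simp add: spL)
  qed (auto simp: prob comp K_def intro!: one)
  then show ?thesis by blast
qed

subsection \<open>Alpha-gamma trees\<close>

datatype 'v site = Edge "'v \<times> 'v" | Vertex 'v

definition sites :: "'v ltree \<Rightarrow> 'v site set" where
  "sites t = Edge ` edges t \<union> Vertex ` {v \<in> verts t. deg t v \<ge> 3}"

fun ag_weight :: "real \<Rightarrow> real \<Rightarrow> 'v ltree \<Rightarrow> 'v site \<Rightarrow> real" where
  "ag_weight \<alpha> \<gamma> t (Edge (a, x)) = (if x \<in> leaves t then 1 - \<alpha> else \<gamma>)"
| "ag_weight \<alpha> \<gamma> t (Vertex v) = (let k = real (deg t v) - 1 in (k - 1) * \<alpha> - \<gamma>)"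

fun grow_site :: "nat \<Rightarrow> vertex ltree \<Rightarrow> vertex site \<Rightarrow> vertex ltree" where
  "grow_site n t (Edge e) = grow_edge n e t"
| "grow_site n t (Vertex v) = grow_vertex n v t"

definition ag_step :: "real \<Rightarrow> real \<Rightarrow> nat \<Rightarrow> vertex ltree \<Rightarrow> vertex ltree pmf" where
  "ag_step \<alpha> \<gamma> n t = map_pmf (grow_site n t) (select (sites t) (ag_weight \<alpha> \<gamma> t))"

abbreviation seq_space :: "(nat \<Rightarrow> 's) measure" where
  "seq_space \<equiv> PiM {1..} (\<lambda>_. count_space UNIV)"

text \<open>
  A random sequence \<open>S\<close> of isomorphism classes is a sequence of alpha-gamma trees if it has the
  distribution of the sequence of isomorphism classes of trees grown by the alpha-gamma rules; the
  rules determine this distribution, so it does not matter which realisation is used.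
\<close>

definition alpha_gamma_trees ::
  "'w measure \<Rightarrow> real \<Rightarrow> real \<Rightarrow> (nat \<Rightarrow> 'w \<Rightarrow> nat ltree set) \<Rightarrow> bool" where
  "alpha_gamma_trees M \<alpha> \<gamma> S \<longleftrightarrow>
     prob_space M \<and>
     (\<forall>n\<ge>1. S n \<in> M \<rightarrow>\<^sub>M count_space UNIV) \<and>
     (\<exists>(N :: (nat \<Rightarrow> vertex ltree) measure) T.
        grown N tree1 tree2 (ag_step \<alpha> \<gamma>) T \<and>
        distr M seq_space (\<lambda>\<omega>. \<lambda>n\<in>{1..}. S n \<omega>) =
        distr N seq_space (\<lambda>\<omega>. \<lambda>n\<in>{1..}. iso_class (T n \<omega>)))"

subsection \<open>Coloured alpha trees and crushing\<close>

datatype colour = Blue | Red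

text \<open>The colouring is a partial map on edges; edges adjacent to a leaf have no colour.\<close>

type_synonym 'v ctree = "'v ltree \<times> ('v \<times> 'v \<rightharpoonup> colour)"

definition ctree1 :: "vertex ctree" where
  "ctree1 = (tree1, Map.empty)"

definition ctree2 :: "vertex ctree" where
  "ctree2 = (tree2, [(Root, Branch 2) \<mapsto> Blue])"

definition alpha_weight :: "real \<Rightarrow> 'v ltree \<Rightarrow> 'v \<times> 'v \<Rightarrow> real" where
  "alpha_weight \<alpha> t = (\<lambda>(a, x). if x \<in> leaves t then 1 - \<alpha> else \<alpha>)"

definition recolour :: "real \<Rightarrow> nat \<Rightarrow> vertex ctree \<Rightarrow> vertex \<times> vertex \<Rightarrow> (vertex \<times> vertex \<rightharpoonup> colour) pmf" where
  "recolour c n = (\<lambda>(t, col) (a, x).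
     let b = Branch (Suc n); kept = col((a, x) := None) in
     if x \<in> leaves t then return_pmf (kept((a, b) \<mapsto> Blue))
     else if col (a, x) = Some Red then return_pmf (kept((a, b) \<mapsto> Red, (b, x) \<mapsto> Red))
     else map_pmf (\<lambda>red. kept((a, b) \<mapsto> Blue, (b, x) \<mapsto> (if red then Red else Blue)))
            (bernoulli_pmf c))"

definition col_step :: "real \<Rightarrow> real \<Rightarrow> nat \<Rightarrow> vertex ctree \<Rightarrow> vertex ctree pmf" where
  "col_step \<alpha> c n = (\<lambda>(t, col).
     bind_pmf (select (edges t) (alpha_weight \<alpha> t))
       (\<lambda>e. map_pmf (\<lambda>col'. (grow_edge n e t, col')) (recolour c n (t, col) e)))"

definition coloured_alpha_trees ::
  "'w measure \<Rightarrow> real \<Rightarrow> real \<Rightarrow> (nat \<Rightarrow> 'w \<Rightarrow> vertex ctree) \<Rightarrow> bool" where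
  "coloured_alpha_trees M \<alpha> c T \<longleftrightarrow> grown M ctree1 ctree2 (col_step \<alpha> c) T"

text \<open>The vertices of the crushed tree are the sets of vertices connected via red edges.\<close>

definition crush :: "'v ctree \<Rightarrow> 'v set ltree" where
  "crush = (\<lambda>(t, col).
     let R = {e \<in> edges t. col e = Some Red};
         cls = (\<lambda>v. (R \<union> R\<inverse>)\<^sup>* `` {v})
     in \<lparr>root_of = cls (root_of t), leaf_at = map_option cls \<circ> leaf_at t,
         edges = map_prod cls cls ` (edges t - R)\<rparr>)"

end

theory Submission
  imports Defs
begin

text \<open>
  Name every class of branch points that are connected by red edges after its oldest member.  Then
  crushing becomes a function of the coloured tree with values in trees on the same vertex type, and
  one step of the coloured growth becomes literally one alpha-gamma growth step of the crushed tree: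
  a selected red edge, or a blue one whose lower half turns red, adds the new leaf at the vertex
  that is the class of the lower end point of the edge; otherwise the new leaf is added in the middle
  of a surviving edge.

  A class of \<open>k - 1\<close> branch points becomes a vertex of degree \<open>k + 1\<close>.  It contains \<open>k - 2\<close> red edges,
  and exactly one blue edge leads into it, so it is selected with weight
  \<open>(k - 2) * \<alpha> + \<alpha> * c = (k - 1) * \<alpha> - \<gamma>\<close>, while a blue edge between branch points is selected as an edge
  with weight \<open>\<alpha> * (1 - c) = \<gamma>\<close>.  Hence the crushed trees form a Markov chain (lumping) with the
  alpha-gamma transition probabilities.
\<close>

subsection \<open>Selection and lumping of growth chains\<close>

lemma select_pmf:
  fixes w :: "'s \<Rightarrow> real"
  assumes fin: "finite S" and nonneg: "\<And>s. s \<in> S \<Longrightarrow> 0 \<le> w s" and pos: "0 < sum w S"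
  shows "pmf (select S w) s = (if s \<in> S then w s / sum w S else 0)"
proof -
  have "(\<integral>\<^sup>+s. ennreal (if s \<in> S then w s / sum w S else 0) \<partial>count_space UNIV)
      = (\<integral>\<^sup>+s. ennreal (w s / sum w S) * indicator S s \<partial>count_space UNIV)"
    by (intro nn_integral_cong) (auto simp: indicator_def)
  also have "\<dots> = (\<integral>\<^sup>+s. ennreal (w s / sum w S) \<partial>count_space S)"
    by (simp add: nn_integral_count_space_indicator)
  also have "\<dots> = (\<Sum>s\<in>S. ennreal (w s / sum w S))"
    using fin by (rule nn_integral_count_space_finite)
  also have "\<dots> = ennreal (\<Sum>s\<in>S. w s / sum w S)"
    using nonneg pos by (intro sum_ennreal) auto
  also have "(\<Sum>s\<in>S. w s / sum w S) = 1"
    using pos by (simp add: sum_divide_distrib[symmetric])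
  finally have "(\<integral>\<^sup>+s. ennreal (if s \<in> S then w s / sum w S else 0) \<partial>count_space UNIV) = 1"
    by simp
  then show ?thesis
    unfolding select_def using nonneg pos by (subst pmf_embed_pmf) auto
qed

text \<open>Each kernel \<open>f s\<close> puts mass 1 on \<open>S'\<close>, so pushing the weights
  forward preserves their total and the two normalisations agree. In this form the edge weights of
  the coloured tree are regrouped into site weights.\<close>

lemma bind_select:
  fixes w :: "'s \<Rightarrow> real" and w' :: "'q \<Rightarrow> real"
  assumes S: "finite S" "\<And>s. s \<in> S \<Longrightarrow> 0 \<le> w s" "0 < sum w S"
    and S': "finite S'" "\<And>s. s \<in> S \<Longrightarrow> set_pmf (f s) \<subseteq> S'"
    and w': "\<And>q. q \<in> S' \<Longrightarrow> w' q = (\<Sum>s\<in>S. w s * pmf (f s) q)"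
  shows "bind_pmf (select S w) f = select S' w'"
proof -
  note sel = select_pmf[of S w, OF S]
  have one: "(\<Sum>q\<in>S'. pmf (f s) q) = 1" if "s \<in> S" for s
    using S' that by (intro sum_pmf_eq_1)
  have tot: "sum w' S' = sum w S"
  proof -
    have "sum w' S' = (\<Sum>q\<in>S'. \<Sum>s\<in>S. w s * pmf (f s) q)" using w' by (rule sum.cong[OF refl])
    also have "\<dots> = (\<Sum>s\<in>S. w s * (\<Sum>q\<in>S'. pmf (f s) q))"
      by (subst sum.swap) (simp add: sum_distrib_left)
    also have "\<dots> = sum w S" using one by simp
    finally show ?thesis .
  qed
  have nn: "0 \<le> w' q" if "q \<in> S'" for q
    using w'[OF that] S by (auto intro!: sum_nonneg)
  have supp: "set_pmf (select S w) \<subseteq> S"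
    by (auto simp: set_pmf_iff sel split: if_splits)
  show ?thesis
  proof (rule pmf_eqI)
    fix q
    have "pmf (bind_pmf (select S w) f) q = (\<Sum>s\<in>S. pmf (f s) q * pmf (select S w) s)"
      unfolding pmf_bind using S(1) supp
      by (intro integral_measure_pmf_real) (auto simp: subset_iff)
    also have "\<dots> = (\<Sum>s\<in>S. w s * pmf (f s) q) / sum w S"
      by (simp add: sel sum_divide_distrib mult.commute)
    also have "\<dots> = pmf (select S' w') q"
    proof (cases "q \<in> S'")
      case True
      then show ?thesis using select_pmf[of S' w', OF S'(1) nn] w' S tot by simp
    next
      case False
      then have "pmf (f s) q = 0" if "s \<in> S" for s
        using S'(2)[OF that] by (auto simp: set_pmf_iff)
      then show ?thesis using select_pmf[of S' w', OF S'(1) nn] S tot False by simp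
    qed
    finally show "pmf (bind_pmf (select S w) f) q = pmf (select S' w') q" .
  qed
qed

lemma set_pmf_select:
  assumes "finite S" "\<And>s. s \<in> S \<Longrightarrow> 0 \<le> w s" "0 < sum w S"
  shows "set_pmf (select S w) \<subseteq> S"
  by (auto simp: set_pmf_iff select_pmf[OF assms] split: if_splits)

lemma pmf_map_bernoulli:
  assumes "0 \<le> p" "p \<le> 1"
  shows "pmf (map_pmf f (bernoulli_pmf p)) q =
    (if f True = q then p else 0) + (if f False = q then 1 - p else 0)"
proof -
  have "f -` {q} = (if f True = q then {True} else {}) \<union> (if f False = q then {False} else {})"
    by (rule set_eqI, case_tac x) auto
  then show ?thesis
    using assms by (simp add: pmf_map measure_measure_pmf_finite)
qed

section \<open>Countably many reachable states, and functions of a growth chain\<close>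

text \<open>The state type may be uncountable, while \<open>grown\<close> speaks of single histories
  only. At each time these states form a countable set in which the chain lies almost surely, and
  invariants of the growth rules are available on it.\<close>

inductive reachable :: "'s \<Rightarrow> 's \<Rightarrow> (nat \<Rightarrow> 's \<Rightarrow> 's pmf) \<Rightarrow> nat \<Rightarrow> 's \<Rightarrow> bool"
  for s1 s2 step where
  "reachable s1 s2 step 1 s1"
| "reachable s1 s2 step 2 s2"
| "\<lbrakk>2 \<le> n; reachable s1 s2 step n x; y \<in> set_pmf (step n x)\<rbrakk> \<Longrightarrow> reachable s1 s2 step (Suc n) y"

lemma countable_reachable: "countable {x. reachable s1 s2 step n x}"
proof (induction n)
  case 0
  have "{x. reachable s1 s2 step 0 x} = {}" by (auto elim: reachable.cases)
  then show ?case by simp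
next
  case (Suc n)
  have "{x. reachable s1 s2 step (Suc n) x} \<subseteq>
      {s1, s2} \<union> (\<Union>x\<in>{x. reachable s1 s2 step n x}. set_pmf (step n x))"
    by (auto elim: reachable.cases)
  moreover have "countable ({s1, s2} \<union> (\<Union>x\<in>{x. reachable s1 s2 step n x}. set_pmf (step n x)))"
    using Suc by (intro countable_Un countable_UN) auto
  ultimately show ?case by (rule countable_subset)
qed

lemma Collect_history_sets:
  assumes "\<And>k. k \<in> {1..n} \<Longrightarrow> X k \<in> M \<rightarrow>\<^sub>M count_space UNIV"
  shows "{\<omega> \<in> space M. \<forall>k\<in>{1..n::nat}. X k \<omega> = h k} \<in> sets M"
proof (rule sets.sets_Collect_finite_All)
  fix k assume "k \<in> {1..n}"
  then have "X k -` {h k} \<inter> space M \<in> sets M" using assms by (intro measurable_sets) auto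
  moreover have "X k -` {h k} \<inter> space M = {\<omega> \<in> space M. X k \<omega> = h k}" by auto
  ultimately show "{\<omega> \<in> space M. X k \<omega> = h k} \<in> sets M" by simp
qed auto

text \<open>\<open>grown\<close> fixes only the point masses of the next state, while a fibre of a
  map may be uncountable. Both sides are measures in \<open>A\<close>; they agree on countable sets,
  and the countable support of the step already carries all the mass.\<close>

lemma grown_history_step:
  assumes g: "grown M s1 s2 step X" and n: "2 \<le> n"
  shows "emeasure M {\<omega> \<in> space M. (\<forall>k\<in>{1..n}. X k \<omega> = h k) \<and> X (Suc n) \<omega> \<in> A} =
    emeasure M {\<omega> \<in> space M. \<forall>k\<in>{1..n}. X k \<omega> = h k} * emeasure (step n (h n)) A"
proof -
  have prob: "prob_space M" and meas: "\<And>k. 1 \<le> k \<Longrightarrow> X k \<in> M \<rightarrow>\<^sub>M count_space UNIV"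
    and eq: "\<And>s. measure M {\<omega> \<in> space M. (\<forall>k\<in>{1..n}. X k \<omega> = h k) \<and> X (Suc n) \<omega> = s} =
        measure M {\<omega> \<in> space M. \<forall>k\<in>{1..n}. X k \<omega> = h k} * pmf (step n (h n)) s"
    using g n by (auto simp: grown_def)
  interpret prob_space M by (rule prob)
  define H where "H = {\<omega> \<in> space M. \<forall>k\<in>{1..n}. X k \<omega> = h k}"
  have H: "H \<in> sets M" unfolding H_def by (rule Collect_history_sets) (simp add: meas)
  \<comment> \<open>This is the unnormalised law of the next state on the history event, so
    histories of probability zero are included.\<close>
  define \<mu> where "\<mu> = distr (density M (indicator H)) (count_space UNIV) (X (Suc n))"
  have pre: "X (Suc n) -` B \<inter> space M \<in> sets M" for B
    using meas[of "Suc n"] by (intro measurable_sets) auto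
  have mu: "emeasure \<mu> B = emeasure M {\<omega> \<in> H. X (Suc n) \<omega> \<in> B}" for B
  proof -
    have "emeasure \<mu> B = emeasure (density M (indicator H)) (X (Suc n) -` B \<inter> space M)"
      unfolding \<mu>_def using meas[of "Suc n"] by (subst emeasure_distr) auto
    also have "\<dots> = emeasure M (H \<inter> (X (Suc n) -` B \<inter> space M))"
      using H pre by (subst emeasure_density) (auto simp: indicator_inter_arith[symmetric])
    also have "H \<inter> (X (Suc n) -` B \<inter> space M) = {\<omega> \<in> H. X (Suc n) \<omega> \<in> B}"
      by (auto simp: H_def)
    finally show ?thesis .
  qed
  have single: "emeasure \<mu> {s} = emeasure M H * pmf (step n (h n)) s" for s
  proof -
    have "{\<omega> \<in> H. X (Suc n) \<omega> \<in> {s}} =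
        {\<omega> \<in> space M. (\<forall>k\<in>{1..n}. X k \<omega> = h k) \<and> X (Suc n) \<omega> = s}"
      by (auto simp: H_def)
    then show ?thesis
      using eq[of s] unfolding mu by (simp add: emeasure_eq_measure H_def ennreal_mult)
  qed
  have cnt: "emeasure \<mu> B = emeasure M H * emeasure (step n (h n)) B" if "countable B" for B
  proof -
    have "emeasure \<mu> B = (\<integral>\<^sup>+s. emeasure \<mu> {s} \<partial>count_space B)"
      using that by (intro emeasure_countable_singleton) (auto simp: \<mu>_def)
    also have "\<dots> = emeasure M H * (\<integral>\<^sup>+s. emeasure (step n (h n)) {s} \<partial>count_space B)"
      unfolding single by (subst nn_integral_cmult) (auto simp: emeasure_pmf_single)
    also have "(\<integral>\<^sup>+s. emeasure (step n (h n)) {s} \<partial>count_space B) = emeasure (step n (h n)) B"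
      using that by (intro emeasure_countable_singleton[symmetric]) auto
    finally show ?thesis .
  qed
  let ?S = "set_pmf (step n (h n))"
  have "emeasure \<mu> ?S = emeasure M H" using cnt[of ?S] by (simp add: measure_pmf.emeasure_eq_1_AE AE_measure_pmf)
  moreover have "emeasure \<mu> UNIV = emeasure M H"
    unfolding mu by simp
  moreover have "finite_measure \<mu>"
    by (rule finite_measureI) (simp add: mu \<mu>_def[THEN arg_cong[where f=space]])
  ultimately have null: "emeasure \<mu> (- ?S) = 0"
    using emeasure_compl[of ?S \<mu>]
    by (simp add: \<mu>_def[THEN arg_cong[where f=space]] \<mu>_def[THEN arg_cong[where f=sets]] Compl_eq_Diff_UNIV
        emeasure_eq_measure ennreal_minus_eq_top)
  have "emeasure \<mu> A = emeasure \<mu> (A \<inter> ?S)"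
    by (rule emeasure_eq_AE) (use null in \<open>auto simp: \<mu>_def intro!: AE_I[where N="- ?S"]\<close>)
  also have "\<dots> = emeasure M H * emeasure (step n (h n)) A"
    by (subst cnt) (auto simp: emeasure_Int_set_pmf intro: countable_subset[of _ ?S])
  finally show ?thesis
    unfolding mu by (simp add: H_def conj_assoc)
qed

text \<open>For a given history the next state lies in the support of the step outside a null set.
  There are countably many reachable histories, so these null sets can be united.\<close>

lemma grown_AE_reachable:
  assumes g: "grown M s1 s2 step X"
  shows "AE \<omega> in M. \<forall>k\<in>{1..n}. reachable s1 s2 step k (X k \<omega>)"
proof (induction n)
  case 0
  then show ?case by simp
next
  case (Suc n)
  consider "n = 0" | "n = 1" | "2 \<le> n" by linarith
  then have "AE \<omega> in M. reachable s1 s2 step (Suc n) (X (Suc n) \<omega>)"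
  proof cases
    case 1
    have "AE \<omega> in M. X 1 \<omega> = s1" using g by (simp add: grown_def)
    then show ?thesis by eventually_elim (auto simp: 1 intro: reachable.intros[simplified])
  next
    case 2
    have "AE \<omega> in M. X 2 \<omega> = s2" using g by (simp add: grown_def)
    then show ?thesis
      by eventually_elim (auto simp: 2 numeral_2_eq_2[symmetric] intro: reachable.intros)
  next
    case 3
    let ?G = "PiE {1..n} (\<lambda>k. {x. reachable s1 s2 step k x})"
    have meas: "\<And>k. 1 \<le> k \<Longrightarrow> X k \<in> M \<rightarrow>\<^sub>M count_space UNIV"
      using g by (auto simp: grown_def)
    have "AE \<omega> in M. \<forall>h\<in>?G. (\<forall>k\<in>{1..n}. X k \<omega> = h k) \<longrightarrow> X (Suc n) \<omega> \<in> set_pmf (step n (h n))"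
    proof (subst AE_ball_countable, intro countable_PiE countable_reachable finite_atLeastAtMost, intro ballI)
      fix h
      let ?N = "{\<omega> \<in> space M. (\<forall>k\<in>{1..n}. X k \<omega> = h k) \<and> X (Suc n) \<omega> \<in> - set_pmf (step n (h n))}"
      have "emeasure (step n (h n)) (- set_pmf (step n (h n))) = 0"
        by (subst emeasure_Int_set_pmf[symmetric]) simp
      then have "emeasure M ?N = 0"
        using grown_history_step[OF g 3, of h "- set_pmf (step n (h n))"] by simp
      moreover have "?N = {\<omega> \<in> space M. \<forall>k\<in>{1..n}. X k \<omega> = h k} \<inter>
          (X (Suc n) -` (- set_pmf (step n (h n))) \<inter> space M)" by auto
      then have "?N \<in> sets M"
        using Collect_history_sets[of n X M h] meas
        by (simp only:) (intro sets.Int measurable_sets[OF meas], auto)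
      ultimately show "AE \<omega> in M. (\<forall>k\<in>{1..n}. X k \<omega> = h k) \<longrightarrow> X (Suc n) \<omega> \<in> set_pmf (step n (h n))"
        by (intro AE_I[where N="?N"]) auto
    qed
    with Suc.IH show ?thesis
    proof eventually_elim
      case (elim \<omega>)
      let ?h = "\<lambda>k\<in>{1..n}. X k \<omega>"
      have "?h \<in> ?G" using elim(1) by auto
      then have "X (Suc n) \<omega> \<in> set_pmf (step n (X n \<omega>))"
        using elim(2)[rule_format, of ?h] 3 by auto
      then show ?case using elim(1) 3 by (auto intro: reachable.intros)
    qed
  qed
  with Suc.IH show ?case by eventually_elim (auto simp: le_Suc_eq)
qed

text \<open>Up to a null set, the event that the image has a given history splits into countably
  many histories of \<open>X\<close>. On each of them the next image state has the same conditional
  law \<open>step' n (h n)\<close>, so this factor comes out of the sum.\<close>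

lemma grown_map:
  assumes g: "grown M s1 s2 step X"
    and step: "\<And>n x. 2 \<le> n \<Longrightarrow> reachable s1 s2 step n x \<Longrightarrow> map_pmf f (step n x) = step' n (f x)"
  shows "grown M (f s1) (f s2) step' (\<lambda>n \<omega>. f (X n \<omega>))"
proof -
  have meas: "\<And>k. 1 \<le> k \<Longrightarrow> X k \<in> M \<rightarrow>\<^sub>M count_space UNIV"
    using g by (auto simp: grown_def)
  interpret prob_space M using g by (simp add: grown_def)
  have fmeas: "(\<lambda>\<omega>. f (X k \<omega>)) \<in> M \<rightarrow>\<^sub>M count_space UNIV" if "1 \<le> k" for k
    using measurable_compose[OF meas[OF that], of f "count_space UNIV"] by simp
  have step_eq: "measure M {\<omega> \<in> space M. (\<forall>k\<in>{1..n}. f (X k \<omega>) = h k) \<and> f (X (Suc n) \<omega>) = s} =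
        measure M {\<omega> \<in> space M. \<forall>k\<in>{1..n}. f (X k \<omega>) = h k} * pmf (step' n (h n)) s"
    if n: "2 \<le> n" for n h s
  proof -
    \<comment> \<open>\<open>G\<close> lists the reachable histories lying over \<open>h\<close>. As
      extensional functions, distinct members differ at some time in \<open>{1..n}\<close>, so their
      events are disjoint.\<close>
    define G where "G = {g \<in> PiE {1..n} (\<lambda>k. {x. reachable s1 s2 step k x}). \<forall>k\<in>{1..n}. f (g k) = h k}"
    define H where "H g = {\<omega> \<in> space M. \<forall>k\<in>{1..n}. X k \<omega> = g k}" for g
    have G: "countable G"
      unfolding G_def
      by (rule countable_subset[of _ "PiE {1..n} (\<lambda>k. {x. reachable s1 s2 step k x})"])
        (auto intro!: countable_PiE countable_reachable simp del: PiE_iff)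
    have Hs: "H g \<in> sets M" for g
      unfolding H_def by (rule Collect_history_sets) (simp add: meas)
    have pre: "X (Suc n) -` B \<inter> space M \<in> sets M" for B
      by (intro measurable_sets[OF meas]) auto
    have disj: "disjoint_family_on (\<lambda>g. {\<omega> \<in> H g. X (Suc n) \<omega> \<in> B}) G" for B
    proof -
      have "g = g'" if "g \<in> G" "g' \<in> G" "\<omega> \<in> H g" "\<omega> \<in> H g'" for g g' \<omega>
        using that unfolding G_def H_def by (intro PiE_ext[of g "{1..n}" _ g']) auto
      then show ?thesis by (fastforce simp: disjoint_family_on_def)
    qed
    have Es: "{\<omega> \<in> space M. (\<forall>k\<in>{1..n}. f (X k \<omega>) = h k) \<and> X (Suc n) \<omega> \<in> B} \<in> sets M" for B
    proof -
      have "{\<omega> \<in> space M. \<forall>k\<in>{1..n}. f (X k \<omega>) = h k} \<inter> (X (Suc n) -` B \<inter> space M) \<in> sets M"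
        by (intro sets.Int Collect_history_sets pre) (simp add: fmeas)
      moreover have "{\<omega> \<in> space M. \<forall>k\<in>{1..n}. f (X k \<omega>) = h k} \<inter> (X (Suc n) -` B \<inter> space M) =
         {\<omega> \<in> space M. (\<forall>k\<in>{1..n}. f (X k \<omega>) = h k) \<and> X (Suc n) \<omega> \<in> B}" by auto
      ultimately show ?thesis by simp
    qed
    have HBs: "{\<omega> \<in> H g. X (Suc n) \<omega> \<in> B} \<in> sets M" for g B
    proof -
      have "H g \<inter> (X (Suc n) -` B \<inter> space M) = {\<omega> \<in> H g. X (Suc n) \<omega> \<in> B}" by (auto simp: H_def)
      then show ?thesis using Hs pre by (metis sets.Int)
    qed
    \<comment> \<open>Applied below with the fibre of \<open>s\<close> for the joint event and with
      \<open>UNIV\<close> for the history alone.\<close>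
    have E: "emeasure M {\<omega> \<in> space M. (\<forall>k\<in>{1..n}. f (X k \<omega>) = h k) \<and> X (Suc n) \<omega> \<in> B} =
        (\<integral>\<^sup>+g. emeasure M {\<omega> \<in> H g. X (Suc n) \<omega> \<in> B} \<partial>count_space G)" for B
    proof -
      have "emeasure M {\<omega> \<in> space M. (\<forall>k\<in>{1..n}. f (X k \<omega>) = h k) \<and> X (Suc n) \<omega> \<in> B} =
          emeasure M (\<Union>g\<in>G. {\<omega> \<in> H g. X (Suc n) \<omega> \<in> B})"
      proof (rule emeasure_eq_AE)
        show "AE \<omega> in M. \<omega> \<in> {\<omega> \<in> space M. (\<forall>k\<in>{1..n}. f (X k \<omega>) = h k) \<and> X (Suc n) \<omega> \<in> B} \<longleftrightarrow>
            \<omega> \<in> (\<Union>g\<in>G. {\<omega> \<in> H g. X (Suc n) \<omega> \<in> B})"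
          using grown_AE_reachable[OF g, of n] AE_space
        proof eventually_elim
          case (elim \<omega>)
          have "(\<lambda>k\<in>{1..n}. X k \<omega>) \<in> G \<and> \<omega> \<in> H (\<lambda>k\<in>{1..n}. X k \<omega>)"
            if "\<forall>k\<in>{1..n}. f (X k \<omega>) = h k"
            using that elim by (auto simp: G_def H_def)
          moreover have "\<forall>k\<in>{1..n}. f (X k \<omega>) = h k" if "g \<in> G" "\<omega> \<in> H g" for g
            using that by (auto simp: G_def H_def)
          ultimately show ?case using elim by blast
        qed
        show "(\<Union>g\<in>G. {\<omega> \<in> H g. X (Suc n) \<omega> \<in> B}) \<in> sets M"
          using G HBs by (intro sets.countable_UN') auto
      qed (rule Es)
      also have "\<dots> = (\<integral>\<^sup>+g. emeasure M {\<omega> \<in> H g. X (Suc n) \<omega> \<in> B} \<partial>count_space G)"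
        using G HBs disj by (intro emeasure_UN_countable) auto
      finally show ?thesis .
    qed
    have "emeasure M {\<omega> \<in> space M. (\<forall>k\<in>{1..n}. f (X k \<omega>) = h k) \<and> X (Suc n) \<omega> \<in> f -` {s}} =
        (\<integral>\<^sup>+g. emeasure M {\<omega> \<in> H g. X (Suc n) \<omega> \<in> f -` {s}} \<partial>count_space G)" by (rule E)
    also have "\<dots> = (\<integral>\<^sup>+g. emeasure M (H g) * ennreal (pmf (step' n (h n)) s) \<partial>count_space G)"
    proof (rule nn_integral_cong)
      fix g assume "g \<in> space (count_space G)"
      then have g': "g \<in> G" by simp
      have n': "n \<in> {1..n}" using n by simp
      have r: "reachable s1 s2 step n (g n)" and fg: "f (g n) = h n"
        using g' n' by (auto simp: G_def)
      have "{\<omega> \<in> H g. X (Suc n) \<omega> \<in> f -` {s}} =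
          {\<omega> \<in> space M. (\<forall>k\<in>{1..n}. X k \<omega> = g k) \<and> X (Suc n) \<omega> \<in> f -` {s}}"
        by (auto simp: H_def)
      then have "emeasure M {\<omega> \<in> H g. X (Suc n) \<omega> \<in> f -` {s}} =
          emeasure M (H g) * emeasure (step n (g n)) (f -` {s})"
        using grown_history_step[OF \<open>grown M s1 s2 step X\<close> n, of g "f -` {s}"]
        by (simp add: H_def)
      also have "emeasure (step n (g n)) (f -` {s}) = ennreal (pmf (step' n (h n)) s)"
        using step[OF n r] fg by (metis measure_pmf.emeasure_eq_measure pmf_map)
      finally show "emeasure M {\<omega> \<in> H g. X (Suc n) \<omega> \<in> f -` {s}} =
          emeasure M (H g) * ennreal (pmf (step' n (h n)) s)" .
    qed
    also have "\<dots> = (\<integral>\<^sup>+g. emeasure M (H g) \<partial>count_space G) * ennreal (pmf (step' n (h n)) s)"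
      by (rule nn_integral_multc) simp
    also have "(\<integral>\<^sup>+g. emeasure M (H g) \<partial>count_space G) =
        emeasure M {\<omega> \<in> space M. \<forall>k\<in>{1..n}. f (X k \<omega>) = h k}"
      using E[of UNIV] by simp
    finally show ?thesis
      by (simp add: emeasure_eq_measure ennreal_mult[symmetric])
  qed
  show ?thesis
    unfolding grown_def
  proof (intro conjI allI impI)
    show "AE \<omega> in M. f (X 1 \<omega>) = f s1" "AE \<omega> in M. f (X 2 \<omega>) = f s2"
      using g by (auto simp: grown_def)
  qed (use fmeas step_eq prob_space_axioms in auto)
qed

text \<open>\<open>alpha_gamma_trees\<close> asks for a realisation on a space of sequences of
  trees, whatever \<open>M\<close> is. The law of the sequence with its coordinate maps is one,
  since \<open>grown\<close> constrains only events determined by the sequence.\<close>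

lemma grown_canonical:
  fixes M :: "'w measure" and X :: "nat \<Rightarrow> 'w \<Rightarrow> 's"
  assumes g: "grown M s1 s2 step X"
  shows "grown (distr M seq_space (\<lambda>\<omega>. \<lambda>n\<in>{1..}. X n \<omega>)) s1 s2 step (\<lambda>n x. x n)"
proof -
  let ?N = "distr M seq_space (\<lambda>\<omega>. \<lambda>n\<in>{1..}. X n \<omega>)"
  have meas: "\<And>k. 1 \<le> k \<Longrightarrow> X k \<in> M \<rightarrow>\<^sub>M count_space UNIV" and prob: "prob_space M"
    and ae: "AE \<omega> in M. X 1 \<omega> = s1" "AE \<omega> in M. X 2 \<omega> = s2"
    using g by (auto simp: grown_def)
  have seq: "(\<lambda>\<omega>. \<lambda>n\<in>{1..}. X n \<omega>) \<in> M \<rightarrow>\<^sub>M seq_space"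
    by (intro measurable_restrict meas) auto
  have comp: "(\<lambda>x. x k) \<in> seq_space \<rightarrow>\<^sub>M count_space (UNIV :: 's set)" if "1 \<le> k" for k :: nat
    using that by (intro measurable_component_singleton) auto
  have eq: "measure ?N {x \<in> space seq_space. P x} = measure M {\<omega> \<in> space M. Q \<omega>}"
    if "{x \<in> space seq_space. P x} \<in> sets (seq_space :: (nat \<Rightarrow> 's) measure)"
      and "\<And>\<omega>. \<omega> \<in> space M \<Longrightarrow> P (\<lambda>n\<in>{1..}. X n \<omega>) = Q \<omega>" for P Q
    using that by (subst measure_distr[OF seq])
      (auto intro!: arg_cong[where f="measure M"] simp: space_PiM)
  have hist: "{x \<in> space seq_space. \<forall>k\<in>{1..n}. x k = h k} \<in> sets seq_space" for n and h :: "nat \<Rightarrow> 's"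
    by (rule Collect_history_sets) (simp add: comp)
  have hist_Suc: "{x \<in> space seq_space. (\<forall>k\<in>{1..n}. x k = h k) \<and> x (Suc n) = s} \<in> sets seq_space"
    for n s and h :: "nat \<Rightarrow> 's"
  proof -
    have "{x \<in> space seq_space. (\<forall>k\<in>{1..n}. x k = h k) \<and> x (Suc n) = s} =
        {x \<in> space seq_space. \<forall>k\<in>{1..Suc n}. x k = (h(Suc n := s)) k}"
      by (auto simp: atLeastAtMostSuc_conv simp del: One_nat_def)
    then show ?thesis using hist by simp
  qed
  have ae': "AE x in ?N. x k = s" if "1 \<le> k" "AE \<omega> in M. X k \<omega> = s" for k s
  proof (subst AE_distr_iff[OF seq])
    have "(\<lambda>x. x k) -` {s} \<inter> space seq_space \<in> sets seq_space"
      using comp[OF that(1)] by (rule measurable_sets) simp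
    moreover have "(\<lambda>x. x k) -` {s} \<inter> space seq_space = {x \<in> space seq_space. x k = s}" by auto
    ultimately show "{x \<in> space seq_space. x k = s} \<in> sets seq_space" by simp
  qed (use that in simp)
  show ?thesis
    unfolding grown_def
  proof (intro conjI allI impI)
    show "prob_space ?N" using prob seq by (rule prob_space.prob_space_distr)
    fix n h s assume n: "2 \<le> (n::nat)"
    have "measure M {\<omega> \<in> space M. (\<forall>k\<in>{1..n}. X k \<omega> = h k) \<and> X (Suc n) \<omega> = s} =
        measure M {\<omega> \<in> space M. \<forall>k\<in>{1..n}. X k \<omega> = h k} * pmf (step n (h n)) s"
      using g n by (simp add: grown_def)
    then show "measure ?N {x \<in> space ?N. (\<forall>k\<in>{1..n}. x k = h k) \<and> x (Suc n) = s} =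
        measure ?N {x \<in> space ?N. \<forall>k\<in>{1..n}. x k = h k} * pmf (step n (h n)) s"
      unfolding space_distr by (subst (1 2) eq) (auto intro: hist hist_Suc)
  qed (use ae ae' comp in auto)
qed

subsection \<open>Crushing with named classes\<close>

definition relabel :: "('v \<Rightarrow> 'w) \<Rightarrow> 'v ltree \<Rightarrow> 'w ltree" where
  "relabel f t = \<lparr>root_of = f (root_of t), leaf_at = map_option f \<circ> leaf_at t,
     edges = map_prod f f ` edges t\<rparr>"

lemma verts_relabel: "verts (relabel f t) = f ` verts t"
proof -
  have "ran (map_option f \<circ> leaf_at t) = f ` ran (leaf_at t)"
    by (force simp: ran_def)
  moreover have "Field (map_prod f f ` E) = f ` Field E" for E
    by (force simp: Field_def)
  ultimately show ?thesis by (simp add: verts_def relabel_def image_Un)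
qed

lemma iso_relabel: "inj_on f (verts t) \<Longrightarrow> iso t (relabel f t)"
  unfolding iso_def 
  by (rule exI[of _ f]) (simp add: verts_relabel bij_betw_def, simp add: relabel_def)

lemma ltree_iso_trans: "iso t t' \<Longrightarrow> iso t' t'' \<Longrightarrow> iso t t''"
  unfolding iso_def
proof (elim exE conjE)
  fix f g
  assume "bij_betw f (verts t) (verts t')" "bij_betw g (verts t') (verts t'')"
    and r: "f (root_of t) = root_of t'" "g (root_of t') = root_of t''"
    and l: "\<forall>i. map_option f (leaf_at t i) = leaf_at t' i" "\<forall>i. map_option g (leaf_at t' i) = leaf_at t'' i"
    and e: "map_prod f f ` edges t = edges t'" "map_prod g g ` edges t' = edges t''"
  then have "bij_betw (g \<circ> f) (verts t) (verts t'')" by (blast intro: bij_betw_trans)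
  moreover have "\<forall>i. map_option (g \<circ> f) (leaf_at t i) = leaf_at t'' i"
    using l by (metis option.map_comp)
  moreover have "map_prod (g \<circ> f) (g \<circ> f) ` edges t = edges t''"
    by (simp only: e[symmetric] image_image map_prod_def case_prod_unfold) simp
  ultimately show "\<exists>f. bij_betw f (verts t) (verts t'') \<and> f (root_of t) = root_of t'' \<and>
      (\<forall>i. map_option f (leaf_at t i) = leaf_at t'' i) \<and> map_prod f f ` edges t = edges t''"
    using r by (intro exI[of _ "g \<circ> f"]) simp
qed

lemma relabel_id_on:
  assumes "\<And>v. v \<in> verts t \<Longrightarrow> f v = v"
  shows "relabel f t = t"
proof -
  have "map_option f (leaf_at t i) = leaf_at t i" for i
    using assms by (cases "leaf_at t i") (auto simp: verts_def ran_def)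
  moreover have "map_prod f f e = e" if "e \<in> edges t" for e
    using that assms edge_verts[of "fst e" "snd e" t] by (cases e) auto
  then have "map_prod f f ` edges t = edges t" by force
  ultimately show ?thesis
    using assms[of "root_of t"] by (simp add: relabel_def verts_def comp_def)
qed

lemma relabel_comp: "relabel f (relabel g t) = relabel (f \<circ> g) t"
  by (simp add: relabel_def image_image map_prod_compose option.map_comp fun_eq_iff comp_def
      prod.map_comp)

text \<open>Relabelling back with the inverse supplies the reverse isomorphism; transitivity, across
  different vertex types, then gives both inclusions.\<close>

lemma iso_class_relabel:
  assumes "inj_on f (verts t)"
  shows "iso_class (relabel f t) = iso_class t"
proof -
  have "relabel (inv_into (verts t) f) (relabel f t) = t"
    unfolding relabel_comp by (rule relabel_id_on) (simp add: assms)
  moreover have "inj_on (inv_into (verts t) f) (verts (relabel f t))"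
    by (simp add: verts_relabel inj_on_inv_into)
  ultimately have "iso (relabel f t) t" using iso_relabel by metis
  with iso_relabel[OF assms] show ?thesis
    unfolding iso_class_def by (auto intro: ltree_iso_trans)
qed

section \<open>Components of a relation and their names\<close>

text \<open>
  A class of connected branch points is named after its oldest member, so that the name does not
  change when the class grows.
\<close>

definition pick :: "vertex set \<Rightarrow> vertex" where
  "pick C = (if \<exists>i. Branch i \<in> C then Branch (LEAST i. Branch i \<in> C) else SOME v. v \<in> C)"

definition component :: "'v rel \<Rightarrow> 'v \<Rightarrow> 'v set" where
  "component R v = (R \<union> R\<inverse>)\<^sup>* `` {v}"

definition rep :: "vertex rel \<Rightarrow> vertex \<Rightarrow> vertex" where
  "rep R v = pick (component R v)"

definition red :: "'v ctree \<Rightarrow> 'v rel" where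
  "red T = {e \<in> edges (fst T). snd T e = Some Red}"

definition crush_rep :: "vertex ctree \<Rightarrow> vertex ltree" where
  "crush_rep T = relabel pick (crush T)"

lemma pick_in: "v \<in> C \<Longrightarrow> pick C \<in> C"
  unfolding pick_def by (auto intro: LeastI someI)

lemma pick_singleton: "pick {v} = v"
  using pick_in[of v "{v}"] by simp

text \<open>The added branch point is at least as young as some member, so the oldest member stays
  the same.\<close>

lemma pick_insert_Branch:
  assumes "Branch i \<in> C" "i \<le> m"
  shows "pick (insert (Branch m) C) = pick C"
proof -
  have "(LEAST j. Branch j \<in> insert (Branch m) C) = (LEAST j. Branch j \<in> C)"
  proof (rule Least_equality)
    show "Branch (LEAST j. Branch j \<in> C) \<in> insert (Branch m) C"
      using LeastI[of "\<lambda>j. Branch j \<in> C", OF assms(1)] by simp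
    fix k assume "Branch k \<in> insert (Branch m) C"
    then show "(LEAST j. Branch j \<in> C) \<le> k"
      using Least_le[of "\<lambda>j. Branch j \<in> C", OF assms(1)] assms(2)
        Least_le[of "\<lambda>j. Branch j \<in> C" k] by auto
  qed
  then show ?thesis using assms(1) by (auto simp: pick_def)
qed

lemma sym_rtrancl_Un_converse: "sym ((R \<union> R\<inverse>)\<^sup>*)"
  by (intro sym_rtrancl) (auto simp: sym_def)

lemma component_refl: "v \<in> component R v"
  by (simp add: component_def)

lemma component_eq:
  assumes "w \<in> component R v"
  shows "component R w = component R v"
proof -
  have "(v, w) \<in> (R \<union> R\<inverse>)\<^sup>*" using assms by (simp add: component_def)
  moreover from this have "(w, v) \<in> (R \<union> R\<inverse>)\<^sup>*"
    using sym_rtrancl_Un_converse by (rule symD[rotated])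
  ultimately show ?thesis by (auto simp: component_def intro: rtrancl_trans)
qed

lemma rep_edge: "(u, v) \<in> R \<Longrightarrow> rep R u = rep R v"
  unfolding rep_def by (subst component_eq[of v R u]) (auto simp: component_def)

lemma component_notin_Field:
  assumes "v \<notin> Field R"
  shows "component R v = {v}"
proof -
  have "w = v" if "(v, w) \<in> (R \<union> R\<inverse>)\<^sup>*" for w
    using that by (rule converse_rtranclE) (use assms in \<open>auto simp: Field_def\<close>)
  then show ?thesis using component_refl[of v R] by (auto simp: component_def)
qed

lemma rep_notin_Field: "v \<notin> Field R \<Longrightarrow> rep R v = v"
  by (simp add: rep_def component_notin_Field pick_singleton)

text \<open>The least index in a class is bounded by the index of any member. Hence the name of an
  old class never equals the branch point created next.\<close>

lemma rep_Branch: "\<exists>j\<le>i. rep R (Branch i) = Branch j"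
proof -
  have "Branch i \<in> component R (Branch i)" by (rule component_refl)
  then show ?thesis unfolding rep_def pick_def by (auto intro!: Least_le)
qed

lemma crush_eq:
  "crush T = \<lparr>root_of = component (red T) (root_of (fst T)),
     leaf_at = map_option (component (red T)) \<circ> leaf_at (fst T),
     edges = map_prod (component (red T)) (component (red T)) ` (edges (fst T) - red T)\<rparr>"
  by (cases T) (simp add: crush_def red_def component_def[abs_def] Let_def)

text \<open>A name belongs to its component, and components that share a vertex are equal. So naming
  the vertices of a crushed tree gives an isomorphic tree.\<close>

lemma inj_on_pick_components: "inj_on pick (range (component R))"
proof (rule inj_onI, clarify)
  fix u v assume eq: "pick (component R u) = pick (component R v)"
  have "pick (component R w) \<in> component R w" for w by (rule pick_in[OF component_refl])
  then show "component R u = component R v" by (metis component_eq eq)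
qed

text \<open>Passes between the crushed tree, whose vertices are sets, and its named version, which
  can be a state of the alpha-gamma chain.\<close>

lemma iso_class_crush_rep: "iso_class (crush_rep T) = iso_class (crush T)"
proof -
  have "verts (crush T) \<subseteq> range (component (red T))"
    by (auto simp: crush_eq verts_def Field_def ran_def)
  then show ?thesis
    unfolding crush_rep_def
    by (intro iso_class_relabel inj_on_subset[OF inj_on_pick_components])
qed

lemma crush_rep_simps:
  "root_of (crush_rep T) = rep (red T) (root_of (fst T))"
  "leaf_at (crush_rep T) = map_option (rep (red T)) \<circ> leaf_at (fst T)"
  "edges (crush_rep T) = map_prod (rep (red T)) (rep (red T)) ` (edges (fst T) - red T)"
proof -
  have r: "rep (red T) = pick \<circ> component (red T)" by (simp add: rep_def fun_eq_iff)
  note defs = crush_rep_def crush_eq relabel_def r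
  show "root_of (crush_rep T) = rep (red T) (root_of (fst T))"
    by (simp add: defs)
  show "leaf_at (crush_rep T) = map_option (rep (red T)) \<circ> leaf_at (fst T)"
    by (simp add: defs fun_eq_iff option.map_comp)
  show "edges (crush_rep T) = map_prod (rep (red T)) (rep (red T)) ` (edges (fst T) - red T)"
    by (simp add: defs map_prod_compose image_comp)
qed

lemma crush_rep_no_red:
  assumes "red T = {}"
  shows "crush_rep T = fst T"
proof -
  have "crush_rep T = relabel (rep {}) (fst T)"
    by (rule ltree.equality) (simp_all add: crush_rep_simps assms relabel_def)
  then show ?thesis by (simp add: relabel_id_on rep_notin_Field)
qed

section \<open>Components after grafting one new vertex\<close>

text \<open>Paths transfer in both directions along the map \<open>h\<close> that collapses
  \<open>b\<close> onto \<open>x\<close>. The equivalence on \<open>(a, b)\<close> covers two cases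
  at once: a red edge whose halves are both red, and a blue edge whose lower half turns red.\<close>

lemma component_graft:
  assumes b: "b \<notin> Field R" and h: "h = (\<lambda>v. if v = b then x else v)"
    and R': "R' \<subseteq> R \<union> {(a, b), (b, x)}" "(b, x) \<in> R'" "R - {(a, x)} \<subseteq> R'"
    and ab: "(a, b) \<in> R' \<longleftrightarrow> (a, x) \<in> R" and ne: "x \<noteq> b" "a \<noteq> b"
  shows "component R' v = {u. h u \<in> component R (h v)}"
proof -
  let ?S = "(R \<union> R\<inverse>)\<^sup>*" and ?S' = "(R' \<union> R'\<inverse>)\<^sup>*"
  have sym': "(u, v) \<in> ?S' \<Longrightarrow> (v, u) \<in> ?S'" for u v
    using sym_rtrancl_Un_converse by (rule symD)
  \<comment> \<open>The edge \<open>(a, x)\<close> may be missing from \<open>R'\<close>; the path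
    through \<open>b\<close> replaces it.\<close>
  have sub: "?S \<subseteq> ?S'"
  proof (rule rtrancl_subset_rtrancl, rule subsetI)
    have base: "(u, w) \<in> ?S'" if "(u, w) \<in> R" for u w
    proof (cases "(u, w) = (a, x)")
      case True
      then have "(a, b) \<in> R'" using ab that by simp
      then have "(a, b) \<in> R' \<union> R'\<inverse>" "(b, x) \<in> R' \<union> R'\<inverse>" using R'(2) by auto
      then have "(a, x) \<in> ?S'" by (meson r_into_rtrancl rtrancl_into_rtrancl)
      then show ?thesis using True by simp
    next
      case False
      then show ?thesis using R'(3) that by (intro r_into_rtrancl) auto
    qed
    fix p assume "p \<in> R \<union> R\<inverse>"
    then show "p \<in> ?S'" using base sym' by (cases p) auto
  qed
  \<comment> \<open>Under \<open>h\<close> the edge \<open>(b, x)\<close> becomes trivial and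
    \<open>(a, b)\<close> becomes \<open>(a, x)\<close>.\<close>
  have hS: "(h u, h w) \<in> ?S" if "(u, w) \<in> ?S'" for u w
    using that
  proof (induction rule: rtrancl_induct)
    case base
    then show ?case by simp
  next
    case (step y z)
    have "(h u, h w) \<in> ?S" if "(u, w) \<in> R'" for u w
    proof -
      consider "(u, w) \<in> R" | "(u, w) = (a, b)" | "(u, w) = (b, x)" using R'(1) \<open>(u, w) \<in> R'\<close> by blast
      then show ?thesis
      proof cases
        case 1
        then have "h u = u" "h w = w" using b by (auto simp: h Field_def)
        then show ?thesis using 1 by auto
      next
        case 2
        then have "h u = a" "h w = x" "(a, x) \<in> R" using that ab ne by (auto simp: h)
        then show ?thesis by auto
      next
        case 3
        then show ?thesis by (simp add: h)
      qed
    qed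
    then have "(h y, h z) \<in> ?S"
      using step(2) sym_rtrancl_Un_converse[of R] by (auto dest: symD)
    with step(3) show ?case by (rule rtrancl_trans)
  qed
  \<comment> \<open>Every vertex is joined to its image by at most the edge \<open>(b, x)\<close>,
    which lifts connections back to \<open>R'\<close>.\<close>
  have id: "(u, h u) \<in> ?S'" for u
    using R'(2) by (auto simp: h)
  have "(v, u) \<in> ?S'" if "(h v, h u) \<in> ?S" for u
    using that sub id[of v] sym'[OF id[of u]] by (meson rtrancl_trans subsetD)
  then show ?thesis using hS by (auto simp: component_def)
qed

text \<open>By \<open>component_graft\<close> the class of \<open>Branch i\<close> gains
  \<open>Branch m\<close>, and the other old classes stay as they are. As \<open>i < m\<close>, the
  enlarged class keeps its name.\<close>

lemma rep_graft:
  assumes b: "Branch m \<notin> Field R"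
    and R': "R' \<subseteq> R \<union> {(a, Branch m), (Branch m, Branch i)}" "(Branch m, Branch i) \<in> R'"
      "R - {(a, Branch i)} \<subseteq> R'"
    and ab: "(a, Branch m) \<in> R' \<longleftrightarrow> (a, Branch i) \<in> R" and ne: "i < m" "a \<noteq> Branch m"
  shows "rep R' = (rep R)(Branch m := rep R (Branch i))"
proof
  fix v
  define h where "h = (\<lambda>v. if v = Branch m then Branch i else v)"
  have "component R' v = {u. h u \<in> component R (h v)}"
    using ne by (intro component_graft[OF b h_def R' ab]) auto
  moreover have "Branch m \<notin> component R (h v)"
  proof
    assume "Branch m \<in> component R (h v)"
    then have "component R (h v) = {Branch m}"
      using component_eq component_notin_Field[OF b] by metis
    then show False using component_refl[of "h v" R] ne by (auto simp: h_def split: if_splits)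
  qed
  ultimately have "component R' v = (if Branch i \<in> component R (h v)
      then insert (Branch m) (component R (h v)) else component R (h v))"
    by (auto simp: h_def)
  then have "rep R' v = rep R (h v)"
    using ne by (auto simp: rep_def intro!: pick_insert_Branch[of i])
  then show "rep R' v = ((rep R)(Branch m := rep R (Branch i))) v" by (simp add: h_def)
qed

subsection \<open>Growth of coloured binary trees\<close>

text \<open>
  \<open>E\<close> is the set of edges of a coloured binary tree, \<open>R\<close> the set of its red edges.  A class of \<open>k\<close> branch
  points joined by red edges should have one blue edge into it and \<open>k + 1\<close> edges out of it.  Since
  \<open>k - 1\<close> red edges end in such a class, the last assumption says so without mentioning \<open>k\<close>, in a
  form that each growth step visibly preserves.
\<close>

locale coloured_edges =
  fixes n :: nat and E R :: "vertex rel"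
  assumes n2: "2 \<le> n"
    and inj_snd: "inj_on snd E"
    and snd_E: "snd ` E = Leaf ` {1..n} \<union> Branch ` {2..n}"
    and fst_E: "fst ` E \<subseteq> insert Root (Branch ` {2..n})"
    and root_edge: "\<And>x y. (Root, x) \<in> E \<Longrightarrow> (Root, y) \<in> E \<Longrightarrow> x = y"
    and red_sub: "R \<subseteq> E"
    and red_inner: "\<And>a x. (a, x) \<in> R \<Longrightarrow> a \<in> range Branch \<and> x \<in> range Branch"
    and no_loop: "\<And>e. e \<in> E - R \<Longrightarrow> rep R (fst e) \<noteq> rep R (snd e)"
    and inj_rep: "inj_on (\<lambda>e. rep R (snd e)) (E - R)"
    and top_edge: "\<And>i. i \<in> {2..n} \<Longrightarrow> \<exists>e\<in>E - R. rep R (snd e) = rep R (Branch i)"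
    and out_card: "\<And>i. i \<in> {2..n} \<Longrightarrow> card {e \<in> E - R. rep R (fst e) = rep R (Branch i)} =
      2 + card {e \<in> R. rep R (snd e) = rep R (Branch i)}"
begin

abbreviation "b \<equiv> Branch (Suc n)"
abbreviation "l \<equiv> Leaf (Suc n)"
abbreviation "\<rho> \<equiv> rep R"

lemma finite_E: "finite E"
  using inj_snd snd_E by (metis finite_Un finite_atLeastAtMost finite_imageI finite_imageD)

lemma finite_R: "finite R"
  using red_sub finite_E by (rule finite_subset)

lemma edgeD:
  assumes "(u, v) \<in> E"
  shows "u = Root \<or> (\<exists>j\<in>{2..n}. u = Branch j)" "(\<exists>j\<in>{1..n}. v = Leaf j) \<or> (\<exists>j\<in>{2..n}. v = Branch j)"
  using assms fst_E snd_E image_eqI[of u fst "(u, v)" E] image_eqI[of v snd "(u, v)" E] by auto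

lemma rep_Root: "\<rho> Root = Root" and rep_Leaf: "\<rho> (Leaf i) = Leaf i"
  by (auto intro!: rep_notin_Field simp: Field_def dest!: red_inner)

lemma new_notin: "(b, v) \<notin> E" "(u, b) \<notin> E" "(l, v) \<notin> E" "(u, l) \<notin> E"
  by (auto dest: edgeD)

lemma new_notin_R: "(b, v) \<notin> R" "(u, b) \<notin> R" "(l, v) \<notin> R" "(u, l) \<notin> R"
  using red_sub new_notin by auto

lemma new_notin_Field: "b \<notin> Field R"
  using new_notin_R by (auto simp: Field_def)

lemma rep_b: "\<rho> b = b"
  using new_notin_Field by (rule rep_notin_Field)

lemma rep_Branch_old:
  assumes "j \<le> n"
  shows "\<rho> (Branch j) \<noteq> b" "\<rho> (Branch j) \<noteq> Leaf k" "\<rho> (Branch j) \<noteq> Root"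
  using rep_Branch[of j R] assms by auto

lemma rep_old:
  assumes "(u, v) \<in> E"
  shows "\<rho> u \<noteq> b" "\<rho> v \<noteq> b" "\<rho> u \<noteq> l" "\<rho> v \<noteq> l" "u \<noteq> b" "v \<noteq> b" "u \<noteq> l" "v \<noteq> l"
  using edgeD[OF assms] by (auto simp: rep_Root rep_Leaf rep_Branch_old)

lemma rep_old_edge:
  assumes "f \<in> E"
  shows "\<rho> (fst f) \<noteq> b" "\<rho> (snd f) \<noteq> b" "\<rho> (fst f) \<noteq> l" "\<rho> (snd f) \<noteq> l"
    "fst f \<noteq> b" "snd f \<noteq> b" "fst f \<noteq> l" "snd f \<noteq> l"
  using rep_old[of "fst f" "snd f"] assms by auto

lemma unique_edge: "(u, v) \<in> E \<Longrightarrow> (u', v) \<in> E \<Longrightarrow> u = u'"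
  using inj_onD[OF inj_snd, of "(u, v)" "(u', v)"] by simp

section \<open>The edge invariant under the kinds of growth step\<close>

text \<open>This is the part of the invariant that does not mention colours. \<open>E'\<close> is
  the same in every case of recolouring, so all cases share it.\<close>

lemma split_edges:
  assumes e: "(a, x) \<in> E" and E': "E' = E - {(a, x)} \<union> {(a, b), (b, x), (b, l)}"
  shows "inj_on snd E'" "snd ` E' = Leaf ` {1..Suc n} \<union> Branch ` {2..Suc n}"
    "fst ` E' \<subseteq> insert Root (Branch ` {2..Suc n})"
    "\<And>y z. (Root, y) \<in> E' \<Longrightarrow> (Root, z) \<in> E' \<Longrightarrow> y = z"
proof -
  show "inj_on snd E'"
    using new_notin rep_old[OF e] unique_edge e unfolding E' inj_on_def by fastforce
  have "snd ` E' = snd ` E \<union> {b, l}" using e unfolding E' by (force simp: image_iff)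
  also have "\<dots> = Leaf ` {1..Suc n} \<union> Branch ` {2..Suc n}"
    using n2 unfolding snd_E by (auto simp: atLeastAtMostSuc_conv)
  finally show "snd ` E' = Leaf ` {1..Suc n} \<union> Branch ` {2..Suc n}" .
  show "fst ` E' \<subseteq> insert Root (Branch ` {2..Suc n})"
  proof -
    have "fst ` E' \<subseteq> insert a (insert b (fst ` E))" unfolding E' by auto
    also have "\<dots> \<subseteq> insert Root (Branch ` {2..Suc n})"
    proof -
      have "Branch ` {2..n} \<subseteq> Branch ` {2..Suc n}" by auto
      then show ?thesis using fst_E edgeD(1)[OF e] n2 by auto
    qed
    finally show ?thesis .
  qed
  show "y = z" if "(Root, y) \<in> E'" "(Root, z) \<in> E'" for y z
    using that root_edge[of y z] root_edge[of x z] root_edge[of y x] e unfolding E' by auto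
qed

text \<open>Both end points of the selected red edge are in one class, and \<open>b\<close> joins
  it. Among the red edges ending in that class one is replaced by two, and \<open>(b, l)\<close> is
  a new outgoing edge, so both sides of \<open>out_card\<close> grow by 1.\<close>

lemma join_red:
  assumes e: "(a, x) \<in> R"
    and E': "E' = E - {(a, x)} \<union> {(a, b), (b, x), (b, l)}"
    and R': "R' = R - {(a, x)} \<union> {(a, b), (b, x)}"
  shows "rep R' = \<rho>(b := \<rho> x)" "E' - R' = insert (b, l) (E - R)" "coloured_edges (Suc n) E' R'"
proof -
  have eE: "(a, x) \<in> E" using e red_sub by auto
  obtain i where i: "x = Branch i" "i \<in> {2..n}" using red_inner[OF e] edgeD(2)[OF eE] by auto
  note old = rep_old[OF eE]
  have ax: "\<rho> a = \<rho> x" using e by (rule rep_edge)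
  show r: "rep R' = \<rho>(b := \<rho> x)"
    unfolding i using e i old by (intro rep_graft[of _ _ _ a] new_notin_Field) (auto simp: R')
  show N: "E' - R' = insert (b, l) (E - R)"
    using old new_notin new_notin_R e unfolding E' R' by auto
  have rE: "rep R' (fst f) = \<rho> (fst f)" "rep R' (snd f) = \<rho> (snd f)" if "f \<in> E" for f
    using rep_old_edge[OF that] by (auto simp: r)
  have rl: "rep R' l = l" "rep R' b = \<rho> x" by (simp_all add: r rep_Leaf)
  have D: "{e \<in> E' - R'. rep R' (fst e) = v} =
      {e \<in> E - R. \<rho> (fst e) = v} \<union> (if v = \<rho> x then {(b, l)} else {})" for v
    unfolding N r using new_notin old by (auto simp: rep_Leaf)
  have I: "{e \<in> R'. rep R' (snd e) = v} = (if v = \<rho> x then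
      insert (a, b) (insert (b, x) ({e \<in> R. \<rho> (snd e) = v} - {(a, x)})) else {e \<in> R. \<rho> (snd e) = v})" for v
    unfolding r unfolding R' using old e new_notin_R by auto
  have cards: "card {e \<in> E' - R'. rep R' (fst e) = \<rho> (Branch j)} =
      2 + card {e \<in> R'. rep R' (snd e) = \<rho> (Branch j)}" if j: "j \<in> {2..n}" for j
  proof (cases "\<rho> (Branch j) = \<rho> x")
    case True
    let ?I = "{e \<in> R. \<rho> (snd e) = \<rho> x}"
    have "Suc (card (?I - {(a, x)})) = card ?I"
      using finite_R e by (intro card_Suc_Diff1) auto
    then have "card (insert (a, b) (insert (b, x) (?I - {(a, x)}))) = Suc (card ?I)"
      using finite_R new_notin_R old by (simp add: card_insert_if)
    moreover have "card ({e \<in> E - R. \<rho> (fst e) = \<rho> x} \<union> {(b, l)}) = Suc (card {e \<in> E - R. \<rho> (fst e) = \<rho> x})"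
      using finite_E new_notin by simp
    ultimately show ?thesis unfolding D I using True out_card[OF j] by simp
  next
    case False
    then show ?thesis unfolding D I using out_card[OF j] by simp
  qed
  \<comment> \<open>The new branch point shares the class of \<open>x\<close>, so it suffices to
    check the classes of old branch points.\<close>
  have repj: "\<exists>j\<in>{2..n}. rep R' (Branch k) = \<rho> (Branch j)" if "k \<in> {2..Suc n}" for k
    using that i by (auto simp: r le_Suc_eq)
  show "coloured_edges (Suc n) E' R'"
  proof
    fix k assume "k \<in> {2..Suc n}"
    then obtain j where j: "j \<in> {2..n}" "rep R' (Branch k) = \<rho> (Branch j)" using repj by blast
    show "card {e \<in> E' - R'. rep R' (fst e) = rep R' (Branch k)} =
      2 + card {e \<in> R'. rep R' (snd e) = rep R' (Branch k)}" using cards[OF j(1)] j(2) by simp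
    obtain f where "f \<in> E - R" "\<rho> (snd f) = \<rho> (Branch j)" using top_edge[OF j(1)] by blast
    then show "\<exists>e\<in>E' - R'. rep R' (snd e) = rep R' (Branch k)"
      unfolding N j(2) by (intro bexI[of _ f]) (auto simp: rE)
  next
    have "inj_on (\<lambda>e. rep R' (snd e)) (E - R)"
      using inj_rep rE by (simp add: inj_on_def)
    moreover have "rep R' (snd f) \<noteq> l" if "f \<in> E - R" for f
      using rE[of f] rep_old_edge[of f] that by simp
    then have "l \<notin> (\<lambda>e. rep R' (snd e)) ` (E - R)"
      by (metis (no_types, lifting) imageE)
    ultimately show "inj_on (\<lambda>e. rep R' (snd e)) (E' - R')"
      unfolding N inj_on_insert by (auto simp: rl)
  next
    fix e assume "e \<in> E' - R'"
    then show "rep R' (fst e) \<noteq> rep R' (snd e)"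
      unfolding N using no_loop[of e] rE[of e] rl old by auto
  next
    fix u v assume "(u, v) \<in> R'"
    then show "u \<in> range Branch \<and> v \<in> range Branch"
      using red_inner e unfolding R' by auto
  next
    show "R' \<subseteq> E'" using red_sub unfolding E' R' by auto
  qed ((fact split_edges[OF eE E'] | rule le_SucI[OF n2])+)
qed

text \<open>The upper half \<open>(a, b)\<close> takes over from \<open>(a, x)\<close> as the
  surviving edge into the class of \<open>x\<close>, to which \<open>b\<close> now belongs. This
  class gains the red edge \<open>(b, x)\<close> and the outgoing edge \<open>(b, l)\<close>, which
  keeps \<open>out_card\<close> balanced.\<close>

lemma join_blue:
  assumes e: "(a, x) \<in> E" "(a, x) \<notin> R" and x: "x = Branch i"
    and E': "E' = E - {(a, x)} \<union> {(a, b), (b, x), (b, l)}"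
    and R': "R' = insert (b, x) R"
  shows "rep R' = \<rho>(b := \<rho> x)" "E' - R' = insert (a, b) (insert (b, l) (E - R - {(a, x)}))"
    "coloured_edges (Suc n) E' R'"
proof -
  have i: "i \<in> {2..n}" using edgeD(2)[OF e(1)] x by auto
  note old = rep_old[OF e(1)]
  have ax: "\<rho> a \<noteq> \<rho> x" using e no_loop[of "(a, x)"] by simp
  show r: "rep R' = \<rho>(b := \<rho> x)"
    unfolding x using e i old red_sub new_notin x
    by (intro rep_graft[of _ _ _ a] new_notin_Field) (auto simp: R')
  show N: "E' - R' = insert (a, b) (insert (b, l) (E - R - {(a, x)}))"
    using old new_notin new_notin_R e x unfolding E' R' by auto
  have rE: "rep R' (fst f) = \<rho> (fst f)" "rep R' (snd f) = \<rho> (snd f)" if "f \<in> E" for f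
    using rep_old_edge[OF that] by (auto simp: r)
  have rl: "rep R' l = l" "rep R' b = \<rho> x" by (simp_all add: r rep_Leaf)
  have D: "{e \<in> E' - R'. rep R' (fst e) = v} =
      (if v = \<rho> a then insert (a, b) ({e \<in> E - R. \<rho> (fst e) = v} - {(a, x)})
       else if v = \<rho> x then insert (b, l) {e \<in> E - R. \<rho> (fst e) = v} else {e \<in> E - R. \<rho> (fst e) = v})" for v
    unfolding N r using new_notin e ax old by (auto simp: rep_Leaf)
  have I: "{e \<in> R'. rep R' (snd e) = v} = (if v = \<rho> x then
      insert (b, x) {e \<in> R. \<rho> (snd e) = v} else {e \<in> R. \<rho> (snd e) = v})" for v
    unfolding r unfolding R' using old e new_notin_R by auto
  have cards: "card {e \<in> E' - R'. rep R' (fst e) = \<rho> (Branch j)} =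
      2 + card {e \<in> R'. rep R' (snd e) = \<rho> (Branch j)}" if j: "j \<in> {2..n}" for j
  proof -
    let ?v = "\<rho> (Branch j)"
    have "card (insert (b, x) {e \<in> R. \<rho> (snd e) = ?v}) = Suc (card {e \<in> R. \<rho> (snd e) = ?v})"
      using finite_R new_notin red_sub by (subst card_insert_disjoint) auto
    moreover have "card (insert (b, l) {e \<in> E - R. \<rho> (fst e) = ?v}) = Suc (card {e \<in> E - R. \<rho> (fst e) = ?v})"
      using finite_E new_notin by (subst card_insert_disjoint) auto
    \<comment> \<open>For the class of \<open>a\<close>, the edge \<open>(a, b)\<close> merely
      replaces \<open>(a, x)\<close>.\<close>
    moreover have "card (insert (a, b) ({e \<in> E - R. \<rho> (fst e) = ?v} - {(a, x)})) =
        card {e \<in> E - R. \<rho> (fst e) = ?v}" if "?v = \<rho> a"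
    proof -
      have "card (insert (a, b) ({e \<in> E - R. \<rho> (fst e) = ?v} - {(a, x)})) =
          Suc (card ({e \<in> E - R. \<rho> (fst e) = ?v} - {(a, x)}))"
        using finite_E new_notin by (subst card_insert_disjoint) auto
      also have "\<dots> = card {e \<in> E - R. \<rho> (fst e) = ?v}"
        using finite_E e that by (intro card_Suc_Diff1) auto
      finally show ?thesis .
    qed
    ultimately show ?thesis unfolding D I using ax out_card[OF j] by auto
  qed
  have repj: "\<exists>j\<in>{2..n}. rep R' (Branch k) = \<rho> (Branch j)" if "k \<in> {2..Suc n}" for k
    using that i x by (auto simp: r le_Suc_eq)
  show "coloured_edges (Suc n) E' R'"
  proof
    fix k assume "k \<in> {2..Suc n}"
    then obtain j where j: "j \<in> {2..n}" "rep R' (Branch k) = \<rho> (Branch j)" using repj by blast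
    show "card {e \<in> E' - R'. rep R' (fst e) = rep R' (Branch k)} =
      2 + card {e \<in> R'. rep R' (snd e) = rep R' (Branch k)}" using cards[OF j(1)] j(2) by simp
    obtain f where f: "f \<in> E - R" "\<rho> (snd f) = \<rho> (Branch j)" using top_edge[OF j(1)] by blast
    \<comment> \<open>If \<open>f\<close> is the selected edge, its upper half is the witness,
      because \<open>b\<close> has the name of \<open>x\<close>.\<close>
    show "\<exists>e\<in>E' - R'. rep R' (snd e) = rep R' (Branch k)"
      unfolding N j(2) using f rl rE
      by (intro bexI[of _ "if f = (a, x) then (a, b) else f"]) auto
  next
    have "\<rho> (snd f) \<noteq> \<rho> x" if "f \<in> E - R - {(a, x)}" for f
      using inj_onD[OF inj_rep, of f "(a, x)"] that e by auto
    moreover have "inj_on (\<lambda>e. rep R' (snd e)) (E - R - {(a, x)})"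
      using inj_rep rE by (simp add: inj_on_def)
    ultimately show "inj_on (\<lambda>e. rep R' (snd e)) (E' - R')"
      unfolding N using rE rl rep_old_edge old by (fastforce simp: inj_on_insert)
  next
    fix e assume "e \<in> E' - R'"
    then show "rep R' (fst e) \<noteq> rep R' (snd e)"
      unfolding N using no_loop[of e] rE[of e] rl old ax \<open>(a, x) \<in> E\<close> rE[of "(a, x)"] by auto
  next
    fix u v assume "(u, v) \<in> R'"
    then show "u \<in> range Branch \<and> v \<in> range Branch"
      using red_inner e x unfolding R' by auto
  next
    show "R' \<subseteq> E'" using red_sub e unfolding E' R' by auto
  qed ((fact split_edges[OF e(1) E'] | rule le_SucI[OF n2])+)
qed

text \<open>The red set is unchanged here; this covers leaf edges as well as blue edges whose halves
  are both blue. The new vertex forms a class of its own.\<close>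

lemma split_blue:
  assumes e: "(a, x) \<in> E" "(a, x) \<notin> R"
    and E': "E' = E - {(a, x)} \<union> {(a, b), (b, x), (b, l)}"
  shows "E' - R = insert (a, b) (insert (b, x) (insert (b, l) (E - R - {(a, x)})))" "coloured_edges (Suc n) E' R"
proof -
  note old = rep_old[OF e(1)]
  have ax: "\<rho> a \<noteq> \<rho> x" using e no_loop[of "(a, x)"] by simp
  show N: "E' - R = insert (a, b) (insert (b, x) (insert (b, l) (E - R - {(a, x)})))"
    using old new_notin new_notin_R e unfolding E' by auto
  have rl: "\<rho> l = l" by (rule rep_Leaf)
  have D: "{e \<in> E' - R. \<rho> (fst e) = v} =
      (if v = \<rho> a then insert (a, b) ({e \<in> E - R. \<rho> (fst e) = v} - {(a, x)})
       else if v = b then {(b, x), (b, l)} else {e \<in> E - R. \<rho> (fst e) = v})" for v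
  proof (cases "v = b")
    case True
    show ?thesis unfolding N True using rep_b old by (auto dest: rep_old(1))
  next
    case False
    then show ?thesis unfolding N using rep_b e ax old by auto
  qed
  show "coloured_edges (Suc n) E' R"
  proof
    fix k assume k: "k \<in> {2..Suc n}"
    show "card {e \<in> E' - R. \<rho> (fst e) = \<rho> (Branch k)} = 2 + card {e \<in> R. \<rho> (snd e) = \<rho> (Branch k)}"
    proof (cases "k = Suc n")
      case True
      \<comment> \<open>The fresh singleton class has the outgoing edges \<open>(b, x)\<close> and
        \<open>(b, l)\<close> and no red edge: the constant 2 in \<open>out_card\<close>.\<close>
      have no: "{e \<in> R. \<rho> (snd e) = b} = {}" using rep_old red_sub by auto
      show ?thesis unfolding True rep_b D no using old by simp
    next
      case False
      then have j: "k \<in> {2..n}" using k by auto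
      let ?v = "\<rho> (Branch k)"
      have "card (insert (a, b) ({e \<in> E - R. \<rho> (fst e) = ?v} - {(a, x)})) =
        card {e \<in> E - R. \<rho> (fst e) = ?v}" if "?v = \<rho> a"
      proof -
        have "card (insert (a, b) ({e \<in> E - R. \<rho> (fst e) = ?v} - {(a, x)})) =
            Suc (card ({e \<in> E - R. \<rho> (fst e) = ?v} - {(a, x)}))"
          using finite_E new_notin by (subst card_insert_disjoint) auto
        also have "\<dots> = card {e \<in> E - R. \<rho> (fst e) = ?v}"
          using finite_E e that by (intro card_Suc_Diff1) auto
        finally show ?thesis .
      qed
      then show ?thesis unfolding D using rep_Branch_old(1)[of k] j out_card[OF j] by auto
    qed
    show "\<exists>e\<in>E' - R. \<rho> (snd e) = \<rho> (Branch k)"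
    proof (cases "k = Suc n")
      case True
      then show ?thesis unfolding N by auto
    next
      case False
      then have "k \<in> {2..n}" using k by auto
      then obtain f where "f \<in> E - R" "\<rho> (snd f) = \<rho> (Branch k)" using top_edge by blast
      then show ?thesis
        unfolding N by (intro bexI[of _ "if f = (a, x) then (b, x) else f"]) auto
    qed
  next
    have "\<rho> (snd f) \<noteq> \<rho> x" if "f \<in> E - R - {(a, x)}" for f
      using inj_onD[OF inj_rep, of f "(a, x)"] that e by auto
    moreover have "inj_on (\<lambda>e. \<rho> (snd e)) (E - R - {(a, x)})"
      using inj_rep by (simp add: inj_on_def)
    ultimately show "inj_on (\<lambda>e. \<rho> (snd e)) (E' - R)"
      unfolding N using rep_b rl rep_old_edge old by (fastforce simp: inj_on_insert)
  next
    fix f assume "f \<in> E' - R"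
    then show "\<rho> (fst f) \<noteq> \<rho> (snd f)"
      unfolding N using no_loop[of f] rl rep_b old by auto
  next
    show "R \<subseteq> E'" using red_sub e unfolding E' by auto
  qed ((fact split_edges[OF e(1) E'] | fact red_inner | rule le_SucI[OF n2])+)
qed

end

subsection \<open>The chain of crushed trees\<close>

context coloured_edges
begin

abbreviation "N \<equiv> E - R"

section \<open>Surviving edges under the class map\<close>

text \<open>The class of the lower end point already separates surviving edges. Degrees and
  selection weights of the crushed tree can therefore be computed on \<open>N\<close>.\<close>

lemma inj_on_map_rep: "inj_on (map_prod \<rho> \<rho>) N"
proof (rule inj_onI)
  fix e f assume "e \<in> N" "f \<in> N" "map_prod \<rho> \<rho> e = map_prod \<rho> \<rho> f"
  then show "e = f" using inj_onD[OF inj_rep, of e f] by (cases e; cases f) auto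
qed

lemma image_rep_upd:
  assumes "S \<subseteq> E"
  shows "map_prod (\<rho>(b := y)) (\<rho>(b := y)) ` S = map_prod \<rho> \<rho> ` S"
proof (rule image_cong[OF refl])
  fix e assume "e \<in> S"
  then show "map_prod (\<rho>(b := y)) (\<rho>(b := y)) e = map_prod \<rho> \<rho> e"
    using rep_old_edge(5,6)[of e] assms by (cases e) auto
qed

lemma image_join_red:
  "map_prod (\<rho>(b := \<rho> x)) (\<rho>(b := \<rho> x)) ` insert (b, l) N = insert (\<rho> x, l) (map_prod \<rho> \<rho> ` N)"
  using image_rep_upd[of N "\<rho> x"] by (simp add: rep_Leaf)

text \<open>The upper half \<open>(a, b)\<close> has the same image as the removed edge, since
  \<open>b\<close> now carries the name of \<open>x\<close>; only the edge to the new leaf is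
  added.\<close>

lemma image_join_blue:
  assumes "(a, x) \<in> N"
  shows "map_prod (\<rho>(b := \<rho> x)) (\<rho>(b := \<rho> x)) ` insert (a, b) (insert (b, l) (N - {(a, x)})) =
    insert (\<rho> x, l) (map_prod \<rho> \<rho> ` N)"
proof -
  have "map_prod \<rho> \<rho> ` N = insert (\<rho> a, \<rho> x) (map_prod \<rho> \<rho> ` (N - {(a, x)}))"
    using assms by force
  moreover have "a \<noteq> b" using assms rep_old[of a x] by simp
  moreover have "N - {(a, x)} \<subseteq> E" by auto
  ultimately show ?thesis using image_rep_upd[of "N - {(a, x)}" "\<rho> x"]
    by (simp add: rep_Leaf insert_commute)
qed

lemma image_split:
  assumes "(a, x) \<in> N"
  shows "map_prod \<rho> \<rho> ` insert (a, b) (insert (b, x) (insert (b, l) (N - {(a, x)}))) =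
    map_prod \<rho> \<rho> ` N - {(\<rho> a, \<rho> x)} \<union> {(\<rho> a, b), (b, \<rho> x), (b, l)}"
proof -
  have "map_prod \<rho> \<rho> ` (N - {(a, x)}) = map_prod \<rho> \<rho> ` N - {(\<rho> a, \<rho> x)}"
    using inj_on_image_set_diff[OF inj_on_map_rep, of N "{(a, x)}"] assms by simp
  then show ?thesis by (simp add: rep_Leaf rep_b)
qed

lemma rep_snd: "(u, v) \<in> E \<Longrightarrow> (\<rho> v \<in> range Leaf \<longleftrightarrow> v \<in> range Leaf) \<and> \<rho> v \<noteq> Root"
  by (drule edgeD(2)) (auto simp: rep_Leaf rep_Branch_old)

lemma rep_fst: "(u, v) \<in> E \<Longrightarrow> \<rho> u \<notin> range Leaf \<and> (\<rho> u = Root \<longleftrightarrow> u = Root)"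
  by (drule edgeD(1)) (auto simp: rep_Root rep_Branch_old)

lemma top_edge_unique:
  assumes "i \<in> {2..n}"
  shows "\<exists>e. {e \<in> N. \<rho> (snd e) = \<rho> (Branch i)} = {e}"
proof -
  obtain e where e: "e \<in> N" "\<rho> (snd e) = \<rho> (Branch i)" using top_edge[OF assms] by blast
  have "f = e" if "f \<in> N" "\<rho> (snd f) = \<rho> (Branch i)" for f
    using inj_onD[OF inj_rep, of f e] that e by simp
  with e have "{e \<in> N. \<rho> (snd e) = \<rho> (Branch i)} = {e}" by blast
  then show ?thesis by blast
qed

end

section \<open>The invariant of coloured trees and one growth step\<close>

text \<open>Red marks are confined to actual edges because the colouring is a partial map on all
  pairs. Only red marks are tracked: \<open>recolour\<close> treats every inner edge not marked red
  as blue.\<close>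

definition coloured_state :: "nat \<Rightarrow> vertex ctree \<Rightarrow> bool" where
  "coloured_state n T \<longleftrightarrow> root_of (fst T) = Root \<and>
     leaf_at (fst T) = (\<lambda>i. if i \<in> {1..n} then Some (Leaf i) else None) \<and>
     {e. snd T e = Some Red} \<subseteq> edges (fst T) \<and> coloured_edges n (edges (fst T)) (red T)"

text \<open>The random recolouring as a function of one coin \<open>r\<close>. The coin is tossed in
  every case, so that edge and coin together determine the step.\<close>

definition recoloured :: "nat \<Rightarrow> vertex ctree \<Rightarrow> vertex \<times> vertex \<Rightarrow> bool \<Rightarrow> vertex \<times> vertex \<rightharpoonup> colour" where
  "recoloured n = (\<lambda>(t, col) (a, x) r.
     let b = Branch (Suc n); kept = col((a, x) := None) in
     if x \<in> leaves t then kept((a, b) \<mapsto> Blue)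
     else if col (a, x) = Some Red then kept((a, b) \<mapsto> Red, (b, x) \<mapsto> Red)
     else kept((a, b) \<mapsto> Blue, (b, x) \<mapsto> (if r then Red else Blue)))"

lemma recolour_eq: "recolour c n T e = map_pmf (recoloured n T e) (bernoulli_pmf c)"
  by (cases T; cases e) (simp add: recolour_def recoloured_def Let_def map_pmf_const)

text \<open>The site at which the crushed tree grows when \<open>e\<close> is selected and the coin
  shows \<open>r\<close>. The leaf test is there because the coin has no effect on leaf
  edges.\<close>

definition site_of :: "vertex ctree \<Rightarrow> vertex \<times> vertex \<Rightarrow> bool \<Rightarrow> vertex site" where
  "site_of T e r = (let \<rho> = rep (red T) in
     if snd e \<notin> leaves (fst T) \<and> (e \<in> red T \<or> r) then Vertex (\<rho> (snd e)) else Edge (map_prod \<rho> \<rho> e))"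

lemma coloured_state_leaves: "coloured_state n T \<Longrightarrow> leaves (fst T) = Leaf ` {1..n}"
  by (auto simp: coloured_state_def leaves_def ran_def)

lemma coloured_state_crush_rep:
  assumes "coloured_state n T"
  shows "root_of (crush_rep T) = Root" "leaf_at (crush_rep T) = leaf_at (fst T)"
    "leaves (crush_rep T) = Leaf ` {1..n}"
proof -
  interpret coloured_edges n "edges (fst T)" "red T"
    using assms by (simp add: coloured_state_def)
  show "root_of (crush_rep T) = Root" and *: "leaf_at (crush_rep T) = leaf_at (fst T)"
    using assms by (auto simp: crush_rep_simps rep_Root rep_Leaf coloured_state_def fun_eq_iff)
  show "leaves (crush_rep T) = Leaf ` {1..n}"
    using coloured_state_leaves[OF assms] * by (simp add: leaves_def)
qed

text \<open>For a fixed edge and coin, crushing commutes with growth. Stable class names make this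
  an equality of trees and not only an isomorphism.\<close>

lemma coloured_state_grow:
  assumes st: "coloured_state n T" and e: "e \<in> edges (fst T)"
  shows "coloured_state (Suc n) (grow_edge n e (fst T), recoloured n T e r)"
    and "crush_rep (grow_edge n e (fst T), recoloured n T e r) =
      grow_site n (crush_rep T) (site_of T e r)"
proof -
  obtain t col where T: "T = (t, col)" by (cases T)
  obtain a x where ax: "e = (a, x)" by (cases e)
  define E R where "E = edges t" and "R = red T"
  interpret coloured_edges n E R
    using st by (simp add: coloured_state_def T E_def R_def)
  have root: "root_of t = Root" and leaf: "leaf_at t = (\<lambda>i. if i \<in> {1..n} then Some (Leaf i) else None)"
    and R: "R = {e. col e = Some Red}"
    using st by (auto simp: coloured_state_def T R_def red_def)
  have leaves: "leaves t = Leaf ` {1..n}" using coloured_state_leaves[OF st] by (simp add: T)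
  have eE: "(a, x) \<in> E" using e by (simp add: ax T E_def)
  have colR: "col f = Some Red \<longleftrightarrow> f \<in> R" for f by (simp add: R)
  define T' where "T' = (grow_edge n e t, recoloured n T e r)"
  define E' where "E' = E - {(a, x)} \<union> {(a, b), (b, x), (b, l)}"
  have edges': "edges (fst T') = E'"
    by (simp add: T'_def grow_edge_def ax E'_def E_def)
  have leaf': "leaf_at (fst T') = (leaf_at t)(Suc n \<mapsto> l)" and root': "root_of (fst T') = Root"
    by (simp_all add: T'_def grow_edge_def ax root)
  have leaf'': "leaf_at (fst T') = (\<lambda>i. if i \<in> {1..Suc n} then Some (Leaf i) else None)"
    unfolding leaf' leaf by (auto simp: fun_eq_iff)
  \<comment> \<open>Both goals are reduced to finding the set \<open>R'\<close> of red marks after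
    the step and checking the edge invariant for it.\<close>
  have state: "coloured_state (Suc n) T'"
    if "{f. snd T' f = Some Red} = R'" "coloured_edges (Suc n) E' R'" for R'
  proof -
    have "R' \<subseteq> E'" using that(2) by (rule coloured_edges.red_sub)
    moreover from this have "red T' = R'" using that(1) by (auto simp: red_def edges')
    ultimately show ?thesis using that leaf'' root' by (simp add: coloured_state_def edges')
  qed
  have crush: "crush_rep T' = crush_rep T
      \<lparr>leaf_at := (leaf_at (crush_rep T))(Suc n \<mapsto> l), edges := map_prod (rep R') (rep R') ` (E' - R')\<rparr>"
    if "{f. snd T' f = Some Red} = R'" "coloured_edges (Suc n) E' R'" for R'
  proof -
    have "R' \<subseteq> E'" using that(2) by (rule coloured_edges.red_sub)
    then have "red T' = R'" using that(1) by (auto simp: red_def edges')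
    then show ?thesis
      using coloured_state_crush_rep[OF state[OF that]] coloured_state_crush_rep[OF st] leaf'
      by (intro ltree.equality) (simp_all add: crush_rep_simps edges' T)
  qed
  have edges_crush: "edges (crush_rep T) = map_prod \<rho> \<rho> ` N"
    by (simp add: crush_rep_simps R_def E_def T)
  have x: "x \<in> leaves t \<or> (\<exists>i. x = Branch i)" "\<not> (x \<in> leaves t \<and> (\<exists>i. x = Branch i))"
    using edgeD(2)[OF eE] by (auto simp: leaves)
  have x_R: "x \<in> leaves t \<Longrightarrow> (a, x) \<notin> R" using red_inner[of a x] x(2) by auto
  note old = rep_old[OF eE]
  consider (leaf) "x \<in> leaves t" | (red) "x \<notin> leaves t" "(a, x) \<in> R"
    | (join) "x \<notin> leaves t" "(a, x) \<notin> R" r | (split) "x \<notin> leaves t" "(a, x) \<notin> R" "\<not> r"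
    by blast
  then have "coloured_state (Suc n) T' \<and> crush_rep T' = grow_site n (crush_rep T) (site_of T e r)"
  proof cases
    case red
    let ?R' = "R - {(a, x)} \<union> {(a, b), (b, x)}"
    have 1: "{f. snd T' f = Some Red} = ?R'"
      using red by (auto simp: T'_def recoloured_def T ax Let_def colR)
    note j = join_red[OF red(2) E'_def refl]
    have "site_of T e r = Vertex (\<rho> x)"
      using red by (simp add: site_of_def ax Let_def T) (simp add: R_def T)
    then show ?thesis
      unfolding crush[OF 1 j(3)] using state[OF 1 j(3)]
      by (simp only: grow_site.simps grow_vertex_def j(1,2) image_join_red edges_crush)
  next
    case join
    then obtain i where i: "x = Branch i" using x by blast
    let ?R' = "insert (b, x) R"
    have 1: "{f. snd T' f = Some Red} = ?R'"
      using join old new_notin_R by (auto simp: T'_def recoloured_def T ax Let_def colR)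
    note j = join_blue[OF eE join(2) i E'_def refl]
    have "site_of T e r = Vertex (\<rho> x)"
      using join by (simp add: site_of_def ax Let_def T) (simp add: R_def T)
    then show ?thesis
      unfolding crush[OF 1 j(3)] using state[OF 1 j(3)] image_join_blue[of a x] eE join
      by (simp add: grow_vertex_def j(1,2) edges_crush)
  next
    case leaf
    have 1: "{f. snd T' f = Some Red} = R"
      using leaf x_R old new_notin_R by (auto simp: T'_def recoloured_def T ax Let_def colR)
    note j = split_blue[OF eE x_R[OF leaf] E'_def]
    have "site_of T e r = Edge (\<rho> a, \<rho> x)"
      using leaf by (simp add: site_of_def ax Let_def T R_def)
    then show ?thesis
      unfolding crush[OF 1 j(2)] using state[OF 1 j(2)] image_split[of a x] eE x_R[OF leaf]
      by (simp add: grow_edge_def j(1) edges_crush)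
  next
    case split
    have 1: "{f. snd T' f = Some Red} = R"
      using split old new_notin_R by (auto simp: T'_def recoloured_def T ax Let_def colR)
    note j = split_blue[OF eE split(2) E'_def]
    have "site_of T e r = Edge (\<rho> a, \<rho> x)"
      using split by (simp add: site_of_def ax Let_def T R_def)
    then show ?thesis
      unfolding crush[OF 1 j(2)] using state[OF 1 j(2)] image_split[of a x] eE split
      by (simp add: grow_edge_def j(1) edges_crush)
  qed
  then show "coloured_state (Suc n) (grow_edge n e (fst T), recoloured n T e r)"
    "crush_rep (grow_edge n e (fst T), recoloured n T e r) = grow_site n (crush_rep T) (site_of T e r)"
    by (simp_all add: T'_def T)
qed

section \<open>Sites, degrees and weights of the crushed tree\<close>

text \<open>A class of branch points has one surviving edge into it and, by \<open>out_card\<close>,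
  two more surviving edges out of it than red edges ending in it. Its degree is thus at least 3,
  while the root and the leaves have degree at most 1.\<close>

lemma sites_crush_rep:
  assumes st: "coloured_state n T"
  shows "sites (crush_rep T) =
      Edge ` map_prod (rep (red T)) (rep (red T)) ` (edges (fst T) - red T) \<union>
      Vertex ` rep (red T) ` Branch ` {2..n}"
    and "\<And>i. i \<in> {2..n} \<Longrightarrow> deg (crush_rep T) (rep (red T) (Branch i)) =
      3 + card {e \<in> red T. rep (red T) (snd e) = rep (red T) (Branch i)}"
proof -
  define E R where "E = edges (fst T)" and "R = red T"
  interpret coloured_edges n E R
    using st by (simp add: coloured_state_def E_def R_def)
  let ?s = "crush_rep T"
  have edges: "edges ?s = map_prod (\<rho>) (\<rho>) ` N"
    by (simp add: crush_rep_simps R_def E_def)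
  have finN: "finite N" using finite_E by simp
  have dg: "deg ?s v = card {e \<in> N. \<rho> (fst e) = v \<or> \<rho> (snd e) = v}" for v
  proof -
    have "{f \<in> edges ?s. fst f = v \<or> snd f = v} =
        map_prod (\<rho>) (\<rho>) ` {e \<in> N. \<rho> (fst e) = v \<or> \<rho> (snd e) = v}"
      unfolding edges by auto
    moreover have "inj_on (map_prod (\<rho>) (\<rho>)) {e \<in> N. \<rho> (fst e) = v \<or> \<rho> (snd e) = v}"
      by (rule inj_on_subset[OF inj_on_map_rep]) auto
    ultimately show ?thesis unfolding deg_def by (simp only: card_image)
  qed
  have deg_rep: "deg ?s (\<rho> (Branch i)) = 3 + card {e \<in> R. \<rho> (snd e) = \<rho> (Branch i)}"
    if i: "i \<in> {2..n}" for i
  proof -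
    let ?v = "\<rho> (Branch i)"
    obtain e where e: "{e \<in> N. \<rho> (snd e) = ?v} = {e}" using top_edge_unique[OF i] by blast
    have "deg ?s ?v = card ({e \<in> N. \<rho> (fst e) = ?v} \<union> {e \<in> N. \<rho> (snd e) = ?v})"
      unfolding dg by (rule arg_cong[where f=card]) auto
    also have "\<dots> = card {e \<in> N. \<rho> (fst e) = ?v} + card {e \<in> N. \<rho> (snd e) = ?v}"
    proof (rule card_Un_disjoint)
      show "finite {e \<in> N. \<rho> (fst e) = ?v}" "finite {e \<in> N. \<rho> (snd e) = ?v}"
        using finN by (auto intro: finite_subset[rotated])
      have "\<not> (\<rho> (fst e) = ?v \<and> \<rho> (snd e) = ?v)" if "e \<in> N" for e
        using no_loop[OF that] by auto
      then show "{e \<in> N. \<rho> (fst e) = ?v} \<inter> {e \<in> N. \<rho> (snd e) = ?v} = {}" by blast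
    qed
    also have "\<dots> = 3 + card {e \<in> R. \<rho> (snd e) = ?v}"
      unfolding e using out_card[OF i] by simp
    finally show ?thesis .
  qed
  then show "\<And>i. i \<in> {2..n} \<Longrightarrow> deg ?s (rep (red T) (Branch i)) =
      3 + card {e \<in> red T. rep (red T) (snd e) = rep (red T) (Branch i)}"
    by (simp add: R_def)
  \<comment> \<open>Only one surviving edge is incident: by \<open>root_edge\<close> at the root and
    by \<open>inj_rep\<close> at a leaf.\<close>
  have deg1: "deg ?s v \<le> 1" if "v = Root \<or> v \<in> range Leaf" for v
  proof -
    have same: "e = f" if "e \<in> N" "\<rho> (fst e) = v \<or> \<rho> (snd e) = v"
      "f \<in> N" "\<rho> (fst f) = v \<or> \<rho> (snd f) = v" for e f
    proof (cases "v = Root")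
      case True
      then have "fst e = Root" "fst f = Root"
        using that rep_fst[of "fst e" "snd e"] rep_snd[of "fst e" "snd e"]
          rep_fst[of "fst f" "snd f"] rep_snd[of "fst f" "snd f"] by auto
      then show ?thesis using root_edge[of "snd e" "snd f"] that by (cases e; cases f) auto
    next
      case False
      then have "\<rho> (snd e) = v" "\<rho> (snd f) = v"
        using that \<open>v = Root \<or> v \<in> range Leaf\<close> rep_fst[of "fst e" "snd e"] rep_fst[of "fst f" "snd f"] by auto
      then show ?thesis using inj_onD[OF inj_rep, of e f] that by simp
    qed
    have fin: "finite {e \<in> N. \<rho> (fst e) = v \<or> \<rho> (snd e) = v}"
      using finN by (rule finite_subset[rotated]) auto
    show ?thesis
      unfolding dg One_nat_def card_le_Suc0_iff_eq[OF fin] using same by blast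
  qed
  have verts: "verts ?s \<subseteq> insert Root (range Leaf) \<union> \<rho> ` Branch ` {2..n}"
  proof -
    have "w \<in> insert Root (range Leaf) \<union> \<rho> ` Branch ` {2..n}" if "w \<in> Field (edges ?s)" for w
    proof -
      from that obtain u v where uv: "(u, v) \<in> E" "w = \<rho> u \<or> w = \<rho> v"
        unfolding edges Field_def by auto
      show ?thesis using edgeD[OF uv(1)] uv(2) by (auto simp: rep_Root rep_Leaf)
    qed
    moreover have "ran (leaf_at ?s) = Leaf ` {1..n}"
      using coloured_state_crush_rep(3)[OF st] by (simp add: leaves_def)
    ultimately show ?thesis
      unfolding verts_def using coloured_state_crush_rep(1)[OF st] by auto
  qed
  have in_verts: "\<rho> (Branch i) \<in> verts ?s" if i: "i \<in> {2..n}" for i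
  proof -
    obtain e where "e \<in> N" "\<rho> (snd e) = \<rho> (Branch i)" using top_edge[OF i] by blast
    then have "(\<rho> (fst e), \<rho> (Branch i)) \<in> edges ?s" unfolding edges by (cases e) force
    then show ?thesis using edge_verts by metis
  qed
  have "{v \<in> verts ?s. deg ?s v \<ge> 3} = \<rho> ` Branch ` {2..n}"
  proof (intro equalityI subsetI)
    fix v assume "v \<in> {v \<in> verts ?s. deg ?s v \<ge> 3}"
    then show "v \<in> \<rho> ` Branch ` {2..n}" using subsetD[OF verts, of v] deg1[of v] by auto
  next
    fix v assume "v \<in> \<rho> ` Branch ` {2..n}"
    then obtain i where "i \<in> {2..n}" "v = \<rho> (Branch i)" by blast
    then show "v \<in> {v \<in> verts ?s. deg ?s v \<ge> 3}" using in_verts deg_rep by simp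
  qed
  then have "sites ?s = Edge ` map_prod \<rho> \<rho> ` N \<union> Vertex ` \<rho> ` Branch ` {2..n}"
    by (simp add: sites_def edges)
  then show "sites ?s = Edge ` map_prod (rep (red T)) (rep (red T)) ` (edges (fst T) - red T) \<union>
      Vertex ` rep (red T) ` Branch ` {2..n}"
    by (simp only: E_def R_def)
qed

text \<open>There is a leaf edge of weight 1 - \<alpha> and an inner edge of weight \<alpha>, and
  these do not vanish together.\<close>

lemma sum_alpha_weight_pos:
  assumes st: "coloured_state n T" and \<alpha>: "0 \<le> \<alpha>" "\<alpha> \<le> 1"
  shows "0 < sum (alpha_weight \<alpha> (fst T)) (edges (fst T))"
    and "\<And>e. 0 \<le> alpha_weight \<alpha> (fst T) e"
proof -
  interpret coloured_edges n "edges (fst T)" "red T"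
    using st by (simp add: coloured_state_def)
  show nonneg: "0 \<le> alpha_weight \<alpha> (fst T) e" for e
    using \<alpha> by (cases e) (simp add: alpha_weight_def)
  have "Leaf 1 \<in> snd ` edges (fst T)" "Branch 2 \<in> snd ` edges (fst T)"
    unfolding snd_E using n2 by auto
  then obtain e f where e: "e \<in> edges (fst T)" "Leaf 1 = snd e" and f: "f \<in> edges (fst T)" "Branch 2 = snd f"
    by blast
  have "0 < alpha_weight \<alpha> (fst T) e \<or> 0 < alpha_weight \<alpha> (fst T) f"
    using e f \<alpha> n2 coloured_state_leaves[OF st]
    by (cases e; cases f) (auto simp: alpha_weight_def)
  then show "0 < sum (alpha_weight \<alpha> (fst T)) (edges (fst T))"
    using e f nonneg finite_E by (auto intro: sum_pos2)
qed

text \<open>Selection weights are regrouped by site. An edge site receives the weight of its only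
  preimage, times 1 - c if that is an inner edge. A vertex site receives \<alpha> from every red
  edge ending in its class and \<alpha> * c from the one surviving edge into it.\<close>

lemma bind_select_site_of:
  assumes st: "coloured_state n T" and \<alpha>: "0 \<le> \<alpha>" "\<alpha> \<le> 1" and c: "0 \<le> c" "c \<le> 1"
  shows "bind_pmf (select (edges (fst T)) (alpha_weight \<alpha> (fst T)))
      (\<lambda>e. map_pmf (site_of T e) (bernoulli_pmf c)) =
    select (sites (crush_rep T)) (ag_weight \<alpha> (\<alpha> * (1 - c)) (crush_rep T))"
proof -
  define E R where "E = edges (fst T)" and "R = red T"
  interpret coloured_edges n E R
    using st by (simp add: coloured_state_def E_def R_def)
  note s = sites_crush_rep[OF st, folded E_def R_def]
  have finN: "finite N" using finite_E by simp
  have lv: "leaves (fst T) = Leaf ` {1..n}" "leaves (crush_rep T) = Leaf ` {1..n}"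
    using coloured_state_leaves[OF st] coloured_state_crush_rep[OF st] by auto
  have leaf_iff: "v \<in> Leaf ` {1..n} \<longleftrightarrow> v \<in> range Leaf" if "(u, v) \<in> E" for u v
    using edgeD(2)[OF that] by auto
  have rep_leaf_iff: "\<rho> v \<in> Leaf ` {1..n} \<longleftrightarrow> v \<in> range Leaf" if "(u, v) \<in> E" for u v
    using edgeD(2)[OF that] by (auto simp: rep_Leaf rep_Branch_old)
  have w: "alpha_weight \<alpha> (fst T) e = (if snd e \<in> range Leaf then 1 - \<alpha> else \<alpha>)" if "e \<in> E" for e
    using that leaf_iff by (cases e) (simp add: alpha_weight_def lv)
  have site: "site_of T e r = (if snd e \<notin> range Leaf \<and> (e \<in> R \<or> r) then Vertex (\<rho> (snd e))
      else Edge (map_prod \<rho> \<rho> e))" if "e \<in> E" for e r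
    using that leaf_iff[of "fst e" "snd e"] by (simp add: site_of_def R_def[symmetric] lv Let_def)
  have red_nonleaf: "snd e \<notin> range Leaf" if "e \<in> R" for e
    using red_inner[of "fst e" "snd e"] that by auto
  show ?thesis
    unfolding E_def[symmetric]
  proof (rule bind_select)
    show "finite E" by (rule finite_E)
    show "0 \<le> alpha_weight \<alpha> (fst T) e" for e by (rule sum_alpha_weight_pos[OF st \<alpha>])
    show "0 < sum (alpha_weight \<alpha> (fst T)) E"
      using sum_alpha_weight_pos[OF st \<alpha>] by (simp add: E_def)
    show "finite (sites (crush_rep T))" unfolding s using finN by simp
    fix e assume e: "e \<in> E"
    have "site_of T e r \<in> sites (crush_rep T)" for r
      using e edgeD(2)[of "fst e" "snd e"] red_nonleaf[of e] unfolding s site[OF e] by auto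
    then show "set_pmf (map_pmf (site_of T e) (bernoulli_pmf c)) \<subseteq> sites (crush_rep T)"
      by auto
  next
    fix q assume "q \<in> sites (crush_rep T)"
    then consider (edge) a x where "(a, x) \<in> N" "q = Edge (\<rho> a, \<rho> x)"
      | (vertex) i where "i \<in> {2..n}" "q = Vertex (\<rho> (Branch i))"
      unfolding s by auto
    then show "ag_weight \<alpha> (\<alpha> * (1 - c)) (crush_rep T) q =
      (\<Sum>e\<in>E. alpha_weight \<alpha> (fst T) e * pmf (map_pmf (site_of T e) (bernoulli_pmf c)) q)"
    proof cases
      case edge
      \<comment> \<open>Red edges lead to vertex sites, and distinct surviving edges have distinct
        images.\<close>
      have "site_of T e r \<noteq> q" if "e \<in> E" "e \<noteq> (a, x)" for e r
        using that edge site[OF that(1), of r] inj_onD[OF inj_on_map_rep, of e "(a, x)"] red_nonleaf[of e] by auto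
      then have "pmf (map_pmf (site_of T e) (bernoulli_pmf c)) q = 0" if "e \<in> E - {(a, x)}" for e
        using that by (simp add: pmf_map_bernoulli[OF c])
      then have "(\<Sum>e\<in>E. alpha_weight \<alpha> (fst T) e * pmf (map_pmf (site_of T e) (bernoulli_pmf c)) q) =
          alpha_weight \<alpha> (fst T) (a, x) * pmf (map_pmf (site_of T (a, x)) (bernoulli_pmf c)) q"
        using edge finite_E by (subst sum.remove[of _ "(a, x)"]) auto
      also have "\<dots> = ag_weight \<alpha> (\<alpha> * (1 - c)) (crush_rep T) q"
        using edge rep_leaf_iff[of a x] by (simp add: w site pmf_map_bernoulli[OF c] lv)
      finally show ?thesis by simp
    next
      case vertex
      let ?v = "\<rho> (Branch i)"
      have v: "?v \<notin> range Leaf" using vertex by (auto simp: rep_Branch_old)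
      have nonleaf: "snd e \<notin> range Leaf" if "e \<in> E" "\<rho> (snd e) = ?v" for e
        using that v rep_snd[of "fst e" "snd e"] by simp
      \<comment> \<open>A red edge gives its vertex for either value of the coin, a surviving one
        only if the coin makes the lower half red.\<close>
      have p: "alpha_weight \<alpha> (fst T) e * pmf (map_pmf (site_of T e) (bernoulli_pmf c)) q =
          (if \<rho> (snd e) = ?v then (if e \<in> R then \<alpha> else \<alpha> * c) else 0)" if "e \<in> E" for e
        using that vertex nonleaf[of e] by (auto simp: w site pmf_map_bernoulli[OF c])
      obtain e where e: "{e \<in> N. \<rho> (snd e) = ?v} = {e}" using top_edge_unique vertex by blast
      have "(\<Sum>e\<in>E. alpha_weight \<alpha> (fst T) e * pmf (map_pmf (site_of T e) (bernoulli_pmf c)) q) =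
          (\<Sum>e\<in>E. if \<rho> (snd e) = ?v then (if e \<in> R then \<alpha> else \<alpha> * c) else 0)"
        using p by (rule sum.cong[OF refl])
      also have "\<dots> = (\<Sum>e\<in>N. if \<rho> (snd e) = ?v then (if e \<in> R then \<alpha> else \<alpha> * c) else 0) +
          (\<Sum>e\<in>R. if \<rho> (snd e) = ?v then (if e \<in> R then \<alpha> else \<alpha> * c) else 0)"
        using finite_E red_sub by (rule sum.subset_diff[rotated])
      also have "(\<Sum>e\<in>N. if \<rho> (snd e) = ?v then (if e \<in> R then \<alpha> else \<alpha> * c) else 0) =
          (\<Sum>e\<in>{e \<in> N. \<rho> (snd e) = ?v}. \<alpha> * c)"
        unfolding sum.inter_filter[OF finN] by (rule sum.cong) auto
      also have "(\<Sum>e\<in>R. if \<rho> (snd e) = ?v then (if e \<in> R then \<alpha> else \<alpha> * c) else 0) =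
          (\<Sum>e\<in>{e \<in> R. \<rho> (snd e) = ?v}. \<alpha>)"
        unfolding sum.inter_filter[OF finite_R] by (rule sum.cong) auto
      also have "(\<Sum>e\<in>{e \<in> N. \<rho> (snd e) = ?v}. \<alpha> * c) + (\<Sum>e\<in>{e \<in> R. \<rho> (snd e) = ?v}. \<alpha>) =
          \<alpha> * c + \<alpha> * card {e \<in> R. \<rho> (snd e) = ?v}"
        unfolding e by simp
      \<comment> \<open>With r red edges ending in the class, \<open>k\<close> in the weight is r +
        2, and (r + 1) * \<alpha> - \<alpha> * (1 - c) = r * \<alpha> + \<alpha> * c.\<close>
      also have "\<dots> = ag_weight \<alpha> (\<alpha> * (1 - c)) (crush_rep T) q"
        unfolding vertex(2) ag_weight.simps s(2)[OF vertex(1)] Let_def by (simp add: algebra_simps)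
      finally show ?thesis by simp
    qed
  qed
qed

section \<open>The one-step law, the starting tree and the conclusion\<close>

lemma col_step_eq:
  "col_step \<alpha> c n T = bind_pmf (select (edges (fst T)) (alpha_weight \<alpha> (fst T)))
     (\<lambda>e. map_pmf (\<lambda>r. (grow_edge n e (fst T), recoloured n T e r)) (bernoulli_pmf c))"
  by (cases T) (simp add: col_step_def recolour_eq map_pmf_comp)

lemma set_pmf_select_edges:
  assumes "coloured_state n T" "0 \<le> \<alpha>" "\<alpha> \<le> 1"
  shows "set_pmf (select (edges (fst T)) (alpha_weight \<alpha> (fst T))) \<subseteq> edges (fst T)"
proof -
  interpret coloured_edges n "edges (fst T)" "red T"
    using assms by (simp add: coloured_state_def)
  show ?thesis using finite_E sum_alpha_weight_pos[OF assms] by (intro set_pmf_select)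
qed

lemma map_crush_rep_col_step:
  assumes st: "coloured_state n T" and \<alpha>: "0 \<le> \<alpha>" "\<alpha> \<le> 1" and c: "0 \<le> c" "c \<le> 1"
  shows "map_pmf crush_rep (col_step \<alpha> c n T) = ag_step \<alpha> (\<alpha> * (1 - c)) n (crush_rep T)"
proof -
  let ?S = "select (edges (fst T)) (alpha_weight \<alpha> (fst T))"
  have "map_pmf crush_rep (col_step \<alpha> c n T) = bind_pmf ?S (\<lambda>e. map_pmf
      (\<lambda>r. crush_rep (grow_edge n e (fst T), recoloured n T e r)) (bernoulli_pmf c))"
    by (simp add: col_step_eq map_bind_pmf map_pmf_comp)
  also have "\<dots> = bind_pmf ?S (\<lambda>e. map_pmf (\<lambda>r. grow_site n (crush_rep T) (site_of T e r)) (bernoulli_pmf c))"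
    using set_pmf_select_edges[OF st \<alpha>] coloured_state_grow(2)[OF st]
    by (intro bind_pmf_cong refl) (auto intro: map_pmf_cong)
  also have "\<dots> = map_pmf (grow_site n (crush_rep T))
      (bind_pmf ?S (\<lambda>e. map_pmf (site_of T e) (bernoulli_pmf c)))"
    by (simp add: map_bind_pmf map_pmf_comp)
  also have "\<dots> = ag_step \<alpha> (\<alpha> * (1 - c)) n (crush_rep T)"
    by (simp add: bind_select_site_of[OF st \<alpha> c] ag_step_def)
  finally show ?thesis .
qed

lemma coloured_state_ctree2: "coloured_state 2 ctree2"
proof -
  have red: "red ctree2 = {}" by (auto simp: red_def ctree2_def)
  have E: "edges (fst ctree2) = {(Root, Branch 2), (Branch 2, Leaf 1), (Branch 2, Leaf 2)}"
    by (simp add: ctree2_def tree2_def)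
  have I: "{2..2} = {2::nat}" "{1..2} = {1, 2::nat}" by auto
  \<comment> \<open>Without red edges every vertex is its own class.\<close>
  have rep_id: "rep {} v = v" for v by (simp add: rep_notin_Field)
  have "coloured_edges 2 (edges (fst ctree2)) {}"
  proof (unfold_locales, unfold E I rep_id)
    fix i :: nat assume "i \<in> {2}"
    moreover have "{e \<in> {(Root, Branch 2), (Branch 2, Leaf 1), (Branch 2, Leaf 2)} - {}. fst e = Branch 2} =
        {(Branch 2, Leaf 1), (Branch 2, Leaf 2)}" by auto
    ultimately show "card {e \<in> {(Root, Branch 2), (Branch 2, Leaf 1), (Branch 2, Leaf 2)} - {}. fst e = Branch i} =
        2 + card {e \<in> {}. snd e = Branch i}" by simp
  qed (auto simp: inj_on_def)
  then show ?thesis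
    by (auto simp: coloured_state_def red) (auto simp: ctree2_def tree2_def fun_eq_iff)
qed

text \<open>The invariant starts with the tree with two leaves and is passed on by every edge in the
  support of the selection; \<open>ctree1\<close> has no branch point and lies outside it.\<close>

lemma reachable_coloured_state:
  assumes "reachable ctree1 ctree2 (col_step \<alpha> c) n T" "2 \<le> n" "0 \<le> \<alpha>" "\<alpha> \<le> 1"
  shows "coloured_state n T"
  using assms(1,2)
proof induction
  case 2
  show ?case by (rule coloured_state_ctree2)
next
  case (3 n T T')
  then have st: "coloured_state n T" by simp
  show ?case
    using 3(3) set_pmf_select_edges[OF st assms(3,4)] coloured_state_grow(1)[OF st]
    by (auto simp: col_step_eq)
qed simp

theorem proposition6:
  fixes \<alpha> c :: real
    and M :: "'w measure"
    and Tcol :: "nat \<Rightarrow> 'w \<Rightarrow> vertex ctree"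
  assumes "0 \<le> \<alpha>" "\<alpha> \<le> 1"
    and "0 \<le> c" "c \<le> 1"
    and "coloured_alpha_trees M \<alpha> c Tcol"
  shows "alpha_gamma_trees M \<alpha> (\<alpha> * (1 - c)) (\<lambda>n \<omega>. iso_class (crush (Tcol n \<omega>)))"
proof -
  have g: "grown M ctree1 ctree2 (col_step \<alpha> c) Tcol"
    using assms by (simp add: coloured_alpha_trees_def)
  define X where "X = (\<lambda>n \<omega>. crush_rep (Tcol n \<omega>))"
  have "crush_rep ctree1 = tree1" "crush_rep ctree2 = tree2"
    by (subst crush_rep_no_red; auto simp: red_def ctree1_def ctree2_def)+
  moreover have "grown M (crush_rep ctree1) (crush_rep ctree2) (ag_step \<alpha> (\<alpha> * (1 - c))) X"
    unfolding X_def using g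
  proof (rule grown_map)
    fix n T assume "2 \<le> n" "reachable ctree1 ctree2 (col_step \<alpha> c) n T"
    then show "map_pmf crush_rep (col_step \<alpha> c n T) = ag_step \<alpha> (\<alpha> * (1 - c)) n (crush_rep T)"
      using assms by (intro map_crush_rep_col_step reachable_coloured_state)
  qed
  ultimately have X: "grown M tree1 tree2 (ag_step \<alpha> (\<alpha> * (1 - c))) X" by simp
  \<comment> \<open>The law of the named crushed sequence serves as the realisation demanded by
    \<open>alpha_gamma_trees\<close>; passing to isomorphism classes identifies it with the given
    sequence.\<close>
  let ?N = "distr M seq_space (\<lambda>\<omega>. \<lambda>n\<in>{1..}. X n \<omega>)"
  have meas: "Tcol n \<in> M \<rightarrow>\<^sub>M count_space UNIV" "X n \<in> M \<rightarrow>\<^sub>M count_space UNIV" if "1 \<le> n" for n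
    using that g X by (auto simp: grown_def)
  have seqX: "(\<lambda>\<omega>. \<lambda>n\<in>{1..}. X n \<omega>) \<in> M \<rightarrow>\<^sub>M seq_space"
    by (intro measurable_restrict meas) auto
  have seq_class: "(\<lambda>x. \<lambda>n\<in>{1..}. iso_class (x n)) \<in> seq_space \<rightarrow>\<^sub>M seq_space"
    by (intro measurable_restrict measurable_compose[OF measurable_component_singleton]) auto
  have "distr ?N seq_space (\<lambda>x. \<lambda>n\<in>{1..}. iso_class (x n)) =
      distr M seq_space (\<lambda>\<omega>. \<lambda>n\<in>{1..}. iso_class (X n \<omega>))"
    unfolding distr_distr[OF seq_class seqX] by (simp add: comp_def restrict_def cong: if_cong)
  then have "distr M seq_space (\<lambda>\<omega>. \<lambda>n\<in>{1..}. iso_class (crush (Tcol n \<omega>))) =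
      distr ?N seq_space (\<lambda>x. \<lambda>n\<in>{1..}. iso_class (x n))"
    by (simp add: X_def iso_class_crush_rep)
  moreover have "(\<lambda>\<omega>. iso_class (crush (Tcol n \<omega>))) \<in> M \<rightarrow>\<^sub>M count_space UNIV" if "1 \<le> n" for n
    using measurable_compose[OF meas(1)[OF that], of "\<lambda>T. iso_class (crush T)" "count_space UNIV"] by simp
  moreover have "prob_space M" using g by (simp add: grown_def)
  ultimately show ?thesis
    unfolding alpha_gamma_trees_def using grown_canonical[OF X] by blast
qed

end
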